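(* Let $n\ge 1$, let $f:S^n\to S^{n+1}$ be a continuous map, and let $I\subset S^n$ be the set of injective points, i.e. the set of points $p\in S^n$ with $f^{-1}(f(p))=\{p\}$. Suppose $I$ contains a set $U$ that is open in $S^n$, and let $q\in U$. Then: (1) $f(S^n)$ separates $S^{n+1}$, i.e. $S^{n+1}-f(S^n)$ is disconnected; write $S^{n+1}-f(S^n)=\coprod_i U_i$ as the disjoint union of its connected components $U_i$, which are open; (2) there are precisely two of these components, say $U_1$ and $U_2$, which contain $f(q)$ in their closure; (3) if $F:\mathbb{D}^{n+1}\to S^{n+1}$ is a continuous extension of $f$ to the closed ball $\mathbb{D}^{n+1}$ (with $\partial\mathbb{D}^{n+1}=S^n$), then $F(\mathbb{D}^{n+1})\supseteq U_1$ or $F(\mathbb{D}^{n+1})\supseteq U_2$. *)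

theory Defs
  imports "HOL-Analysis.Analysis"
begin

definition injective_points :: "'a set \<Rightarrow> ('a \<Rightarrow> 'b) \<Rightarrow> 'a set" where
  "injective_points S f = {p \<in> S. S \<inter> f -` {f p} = {p}}"

end

theory Submission
  imports Defs "HOL-Homology.Homology"
begin

text \<open>
  Let \<open>D\<close> be a small closed cap around \<open>q\<close> consisting of injective points, \<open>A\<close> the image of the
  complementary cap, and \<open>W\<close> the component of \<open>f q\<close> in the complement of \<open>A\<close>. The components of
  \<open>W - f(D)\<close> are exactly the components of the complement of the image of \<open>f\<close> that lie in \<open>W\<close>.

  There are at most two of them: by excision \<open>H\<^sub>1(W, W - f(D))\<close> is \<open>H\<^sub>1\<close> of the pair of complements
  of \<open>f(\<partial>D)\<close> and \<open>f(D)\<close>, which is a quotient of the cyclic group \<open>H\<^sub>1(S\<^sup>n\<^sup>+\<^sup>1 - f(\<partial>D))\<close> because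
  \<open>f(D)\<close> does not separate; so the reduced \<open>H\<^sub>0(W - f(D))\<close> is cyclic.

  There are at least two, and (3) holds, because collapsing the complement of \<open>W - f(D)\<close> outside
  \<open>f(D)\<close> to a point gives a map \<open>r\<close> to \<open>S\<^sup>n\<close> such that \<open>r \<circ> f\<close> is homotopic to the identity.
  The map \<open>r\<close> extends to the complement of any set \<open>L\<close> meeting all components of \<open>W - f(D)\<close>, so \<open>f\<close>
  is not nullhomotopic in the complement of such an \<open>L\<close>; but it would be if \<open>L\<close> were a point, or
  if an extension to the ball avoided \<open>L\<close>.

  Shrinking \<open>D\<close> shrinks \<open>W\<close> but leaves the two components unchanged, and both of them come close to
  the image of the cap since \<open>W\<close> is connected. Hence both have \<open>f q\<close> in their closure.
\<close>

section \<open>Homology and the number of components\<close>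

text \<open>\<open>H_0\<close> is free on the path components, and its reduced part is the kernel of
  the map to \<open>H_0\<close> of a point. Three distinct components would give two independent
  elements of this kernel, which no cyclic group contains.\<close>

lemma cyclic_reduced_homology_group_0_imp_path_components:
  assumes cyc: "cyclic_group (reduced_homology_group 0 X)"
    and ABC: "A \<in> path_components_of X" "B \<in> path_components_of X" "C \<in> path_components_of X"
  shows "A = B \<or> B = C \<or> A = C"
proof (rule ccontr)
  assume neg: "\<not> ?thesis"
  let ?F = "free_Abelian_group (path_components_of X)"
  let ?H = "homology_group 0 X"
  let ?R = "reduced_homology_group 0 X"
  let ?pt = "discrete_topology {()}"
  let ?h = "hom_induced 0 X {} ?pt {} (\<lambda>x. ())"
  obtain \<iota> where \<iota>: "\<iota> \<in> iso ?F ?H"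
    using zeroth_homology_group [of X] group.iso_sym group_relative_homology_group is_iso_def
    by (metis all_not_in_conv)
  obtain \<kappa> where \<kappa>: "\<kappa> \<in> iso (homology_group 0 ?pt) integer_group"
    using homology_coefficients [of ?pt "()"] by (auto simp: is_iso_def)
  interpret F: group ?F by simp
  interpret H: group ?H by simp
  interpret R: group ?R by simp
  have h_hom: "?h \<in> hom ?H (homology_group 0 ?pt)"
    by (rule hom_induced_hom)
  \<comment> \<open>The augmentation, read through the isomorphisms \<open>\<iota>\<close> and
    \<open>\<kappa>\<close> as an integer-valued map on the free group.\<close>
  define \<phi> where "\<phi> = (\<lambda>u. \<kappa> (?h (\<iota> u)))"
  have \<phi>_hom: "\<phi> \<in> hom ?F integer_group"
    unfolding \<phi>_def using \<iota> \<kappa> h_hom 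
    by (auto simp: iso_def hom_def Pi_iff)
  interpret \<phi>: group_hom ?F integer_group \<phi>
    by (simp add: group_hom.intro group_hom_axioms.intro \<phi>_hom)
  have \<phi>_add: "\<phi> (x + y) = \<phi> x + \<phi> y" if "Poly_Mapping.keys x \<subseteq> path_components_of X" "Poly_Mapping.keys y \<subseteq> path_components_of X" for x y
    using \<phi>.hom_mult [of x y] that by simp
  have \<phi>_cmul: "\<phi> (frag_cmul k x) = k * \<phi> x" if "Poly_Mapping.keys x \<subseteq> path_components_of X" for k x
    using \<phi>.hom_int_pow [of x k] that by (simp add: int_pow_free_Abelian_group )
  obtain z where z: "z \<in> carrier ?R" "carrier ?R = range (\<lambda>n::int. z [^]\<^bsub>?R\<^esub> n)"
    using cyc R.cyclic_group by blast
  have zH: "z \<in> carrier ?H"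
    using z(1) carrier_reduced_homology_group_subset by blast
  obtain w where w: "w \<in> carrier ?F" "\<iota> w = z"
    using \<iota> zH by (metis (no_types, lifting) bij_betw_iff_bijections iso_iff image_iff)
  have ker: "\<exists>n::int. u = frag_cmul n w" if u: "Poly_Mapping.keys u \<subseteq> path_components_of X" "\<phi> u = 0" for u
  proof -
    have uF: "u \<in> carrier ?F" using u by simp
    have "?h (\<iota> u) = \<one>\<^bsub>homology_group 0 ?pt\<^esub>"
    proof -
      have "?h (\<iota> u) \<in> carrier (homology_group 0 ?pt)" by (rule hom_induced_carrier)
      moreover have "\<kappa> \<one>\<^bsub>homology_group 0 ?pt\<^esub> = 0"
        using hom_one [of \<kappa> "homology_group 0 ?pt" integer_group] \<kappa> by (simp add: iso_def)
      moreover have "inj_on \<kappa> (carrier (homology_group 0 ?pt))" using \<kappa> by (simp add: iso_iff)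
      ultimately show ?thesis
        using u(2) group.is_monoid[OF group_relative_homology_group] unfolding \<phi>_def
        by (metis inj_onD group_relative_homology_group group.is_monoid monoid.one_closed)
    qed
    moreover have \<iota>u: "\<iota> u \<in> carrier ?H" using \<iota> uF by (auto simp: iso_def hom_def)
    ultimately have "\<iota> u \<in> carrier ?R"
      by (simp add: carrier_reduced_homology_group kernel_def)
    then obtain n::int where "\<iota> u = z [^]\<^bsub>?R\<^esub> n" using z by blast
    also have "\<dots> = z [^]\<^bsub>?H\<^esub> n"
      using z(1) unfolding reduced_homology_group_def by (simp add: H.int_pow_subgroup_generated)
    also have "\<dots> = \<iota> (w [^]\<^bsub>?F\<^esub> n)"
      using \<iota> w hom_int_pow [of \<iota> ?F ?H w n] by (simp add: iso_def)
    finally have "\<iota> u = \<iota> (w [^]\<^bsub>?F\<^esub> n)" .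
    then have "u = w [^]\<^bsub>?F\<^esub> n"
      using \<iota> uF F.int_pow_closed [OF w(1)] by (metis inj_onD iso_iff)
    then show ?thesis using w by (auto simp: int_pow_free_Abelian_group)
  qed
  have zero: "\<phi> (frag_of A) = 0"
    if ABC': "A \<in> path_components_of X" "B \<in> path_components_of X" "C \<in> path_components_of X" "A \<noteq> B" "B \<noteq> C" "A \<noteq> C"
    for A B C
  proof (rule ccontr)
    assume nz: "\<phi> (frag_of A) \<noteq> 0"
    \<comment> \<open>The obvious kernel element supported on \<open>A\<close> and \<open>D\<close>.
      As \<open>u B\<close> and \<open>u C\<close> are multiples of the same \<open>w\<close>, the
      coefficient of \<open>w\<close> at \<open>C\<close> would have to be both zero and
      nonzero.\<close>
    define u where "u D = frag_cmul (\<phi> (frag_of D)) (frag_of A) + frag_cmul (- \<phi> (frag_of A)) (frag_of D)" for D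
    have ex: "\<exists>n. u D = frag_cmul n w" if D: "D \<in> path_components_of X" for D
    proof (rule ker)
      have *: "Poly_Mapping.keys (frag_cmul k (frag_of E)) \<subseteq> path_components_of X" if "E \<in> path_components_of X" for k E
        using that keys_cmul [of k "frag_of E"] by auto
      show "Poly_Mapping.keys (u D) \<subseteq> path_components_of X"
        unfolding u_def
        by (rule order_trans [OF keys_add Un_least]) (use * D \<open>A \<in> _\<close> in blast)+
      show "\<phi> (u D) = 0"
        unfolding u_def \<phi>_add [OF * [OF \<open>A \<in> _\<close>] * [OF D]]
        using D \<open>A \<in> _\<close> by (simp add: \<phi>_cmul)
    qed
    obtain m n where mn: "u B = frag_cmul m w" "u C = frag_cmul n w"
      using ex [OF ABC'(2)] ex [OF ABC'(3)] by (elim exE)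
    have "m * Poly_Mapping.lookup w B = - \<phi> (frag_of A)" "m * Poly_Mapping.lookup w C = 0"
        "n * Poly_Mapping.lookup w C = - \<phi> (frag_of A)"
      using arg_cong [OF mn(1), of "\<lambda>v. Poly_Mapping.lookup v B"] arg_cong [OF mn(1), of "\<lambda>v. Poly_Mapping.lookup v C"]
        arg_cong [OF mn(2), of "\<lambda>v. Poly_Mapping.lookup v C"] ABC'
      by (simp_all add: u_def lookup_add)
    then show False using nz by auto
  qed
  \<comment> \<open>Now two generators lie in the kernel themselves. Being multiples of one
    \<open>w\<close>, they could not have disjoint supports.\<close>
  have "\<phi> (frag_of A) = 0" "\<phi> (frag_of B) = 0"
    using zero [of A B C] zero [of B A C] ABC neg by auto
  then obtain m n where mn: "frag_of A = frag_cmul m w" "frag_of B = frag_cmul n w"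
    using ker [of "frag_of A"] ker [of "frag_of B"] ABC by (auto simp del: lookup_frag_of)
  have "m * Poly_Mapping.lookup w x = (if x = A then 1 else 0)" "n * Poly_Mapping.lookup w x = (if x = B then 1 else 0)" for x
    using arg_cong [OF mn(1), of "\<lambda>u. Poly_Mapping.lookup u x"] arg_cong [OF mn(2), of "\<lambda>u. Poly_Mapping.lookup u x"]
    by simp_all
  from this(1) [of A] this(1) [of B] this(2) [of B] neg
  have "m * Poly_Mapping.lookup w A = 1" "m * Poly_Mapping.lookup w B = 0" "n * Poly_Mapping.lookup w B = 1"
    by metis+
  then have "m \<noteq> 0" "Poly_Mapping.lookup w B = 0" "Poly_Mapping.lookup w B \<noteq> 0"
    by force+
  then show False by auto
qed

text \<open>The class of a constant simplex generates the infinite cyclic group \<open>H_0\<close>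
  and goes to such a generator for the point, so the augmentation is injective.\<close>

lemma trivial_reduced_homology_group_0_path_connected:
  assumes X: "path_connected_space X"
  shows "trivial_group (reduced_homology_group 0 X)"
proof (cases "topspace X = {}")
  case True then show ?thesis by (rule trivial_reduced_homology_group_empty)
next
  case False
  then obtain a where a: "a \<in> topspace X" by blast
  let ?H = "homology_group 0 X"
  let ?pt = "discrete_topology {()}"
  let ?G = "homology_group 0 ?pt"
  let ?h = "hom_induced 0 X {} ?pt {} (\<lambda>x. ())"
  define f where "f = restrict (\<lambda>x. a) (standard_simplex 0)"
  have f: "singular_simplex 0 X f"
    using a by (simp add: singular_simplex_def f_def)
  define q where "q = homologous_rel_set 0 X {} (frag_of f)"
  define q' where "q' = ?h q"
  have cont: "continuous_map X ?pt (\<lambda>x. ())" by simp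
  have cyc: "singular_relcycle 0 X {} (frag_of f)"
    using f by (simp add: singular_cycle singular_chain_of chain_boundary_def)
  have qH: "q \<in> carrier ?H"
    unfolding q_def using cyc by (auto simp: carrier_relative_homology_group_0)
  have "q' = homologous_rel_set 0 ?pt {} (frag_of (simplex_map 0 (\<lambda>x. ()) f))"
    unfolding q'_def q_def using hom_induced_chain_map [OF cont _ cyc, of "{}"] by simp
  moreover have "singular_simplex 0 ?pt (simplex_map 0 (\<lambda>x. ()) f)"
    using f cont by (rule singular_simplex_simplex_map)
  ultimately have iso': "pow ?G q' \<in> iso integer_group ?G"
    by (simp add: iso_integer_zeroth_homology_group path_connected_space_discrete_topology)
  have iso: "pow ?H q \<in> iso integer_group ?H"
    unfolding q_def using X f by (rule iso_integer_zeroth_homology_group)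
  have h_hom: "?h \<in> hom ?H ?G"
    by (rule hom_induced_hom)
  have "x = \<one>\<^bsub>?H\<^esub>" if x: "x \<in> carrier (reduced_homology_group 0 X)" for x
  proof -
    have "x \<in> carrier ?H" "?h x = \<one>\<^bsub>?G\<^esub>"
      using x by (auto simp: carrier_reduced_homology_group kernel_def)
    obtain n::int where n: "x = q [^]\<^bsub>?H\<^esub> n"
      using iso \<open>x \<in> carrier ?H\<close> by (auto simp: iso_iff)
    have inj: "inj (pow ?G q' :: int \<Rightarrow> _)"
      using iso' by (simp add: iso_iff)
    have "q' [^]\<^bsub>?G\<^esub> n = \<one>\<^bsub>?G\<^esub>"
      using hom_int_pow [OF h_hom, of q n] qH n \<open>?h x = _\<close> by (simp add: q'_def)
    then have "q' [^]\<^bsub>?G\<^esub> n = q' [^]\<^bsub>?G\<^esub> (0::int)" by simp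
    then have "n = 0" by (rule injD [OF inj])
    then show ?thesis using n by simp
  qed
  moreover have "\<one>\<^bsub>?H\<^esub> \<in> carrier (reduced_homology_group 0 X)"
    using monoid.one_closed [OF group.is_monoid [OF group_reduced_homology_group [of 0 X]]]
    by (simp add: one_reduced_homology_group)
  ultimately show ?thesis
    unfolding trivial_group_def one_reduced_homology_group
    by (intro conjI group_reduced_homology_group) blast
qed

section \<open>Exact sequences and excision\<close>

lemma exact_seq_trivial_imp_epi:
  assumes ex: "exact_seq ([G1, G2, G3], [g, h])" and triv: "trivial_group G1"
  shows "h \<in> epi G3 G2"
proof -
  have "group_hom G3 G2 h" using ex by simp
  moreover have "h ` carrier G3 = kernel G2 G1 g" using ex by simp
  moreover have "kernel G2 G1 g = carrier G2"
    using ex triv by (auto simp: kernel_def trivial_group_def hom_def)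
  ultimately show ?thesis by (simp add: epi_def group_hom_def group_hom_axioms_def)
qed

text \<open>In the application \<open>P\<close> and \<open>T\<close> are the images of the cap and
  of its rim. With \<open>N\<close>, \<open>Q\<close> the complements of \<open>T\<close>,
  \<open>P\<close> and \<open>V = W - P\<close>, cyclicity passes from \<open>H_1(N)\<close> onto
  \<open>H_1(N, Q)\<close>, by excision to \<open>H_1(W, V)\<close>, and by the boundary map onto
  the reduced \<open>H_0(V)\<close>.\<close>

lemma path_components_of_open_minus_closed:
  fixes X :: "'a topology"
  assumes P: "closedin X P" and T: "closedin X T" "T \<subseteq> P" and W: "openin X W" "W \<inter> P = P - T"
    and cyc: "cyclic_group (reduced_homology_group 1 (subtopology X (topspace X - T)))"
    and pcP: "path_connectedin X (topspace X - P)" and ne: "topspace X - P \<noteq> {}"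
    and pcW: "path_connectedin X W"
    and ABC: "A \<in> path_components_of (subtopology X (W - P))"
             "B \<in> path_components_of (subtopology X (W - P))"
             "C \<in> path_components_of (subtopology X (W - P))"
  shows "A = B \<or> B = C \<or> A = C"
proof -
  define N where "N = topspace X - T"
  define Q where "Q = topspace X - P"
  define Y where "Y = subtopology X N"
  define V where "V = W - P"
  have sub: "Q \<subseteq> N" "W \<subseteq> N" "V \<subseteq> W" "W \<subseteq> topspace X"
    using T W openin_subset [OF W(1)] by (auto simp: Q_def N_def V_def)
  have top: "topspace Y = N" by (auto simp: Y_def N_def)
  have YQ: "subtopology Y Q = subtopology X Q" and YW: "subtopology Y W = subtopology X W"
      and WV: "subtopology (subtopology X W) V = subtopology X V"
    using sub by (simp_all add: Y_def subtopology_subtopology Int_absorb1 Int_absorb2)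
  \<comment> \<open>Surjective because the next term of the exact sequence is the reduced
    \<open>H_0\<close> of the path connected set \<open>Q\<close>.\<close>
  have "hom_induced 1 Y {} Y Q id \<in> epi (reduced_homology_group 1 Y) (relative_homology_group 1 Y Q)"
  proof (rule exact_seq_trivial_imp_epi)
    show "exact_seq ([reduced_homology_group (1 - 1) (subtopology Y Q), relative_homology_group 1 Y Q,
                   reduced_homology_group 1 Y], [hom_boundary 1 Y Q, hom_induced 1 Y {} Y Q id])"
      by (rule homology_exactness_reduced_1) (use ne sub top in \<open>auto simp: Q_def\<close>)
    show "trivial_group (reduced_homology_group (1 - 1) (subtopology Y Q))"
      using pcP unfolding YQ by (simp add: Q_def path_connectedin_def trivial_reduced_homology_group_0_path_connected)
  qed
  then have 1: "cyclic_group (relative_homology_group 1 Y Q)"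
    using cyc group.cyclic_group_epimorphic_image group_reduced_homology_group group_relative_homology_group
    unfolding Y_def N_def by blast
  have clo: "closedin Y (N - W)"
    unfolding Y_def using W(1) by (metis Diff_Diff_Int N_def Y_def closedin_def Diff_subset inf.commute openin_subtopology_Int2 top)
  have opQ: "openin Y Q"
    unfolding Y_def using P sub by (metis Q_def inf.absorb_iff2 openin_diff openin_subtopology_Int2 openin_topspace)
  have "hom_induced 1 (subtopology Y (N - (N - W))) (Q - (N - W)) (subtopology Y N) Q id
     \<in> iso (relative_homology_group 1 (subtopology Y (N - (N - W))) (Q - (N - W)))
           (relative_homology_group 1 (subtopology Y N) Q)"
  proof (rule homology_excision_axiom)
    \<comment> \<open>By \<open>W \<inter> P = P - T\<close> the excised set \<open>N - W\<close>
      misses \<open>P\<close>. It is closed in \<open>Y\<close> and \<open>Q\<close> is open, so the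
      closure and interior in the excision condition change nothing.\<close>
    have "N - W \<subseteq> Q" using W(2) by (auto simp: N_def Q_def)
    then show "Y closure_of (N - W) \<subseteq> Y interior_of Q"
      unfolding closure_of_closedin [OF clo] interior_of_openin [OF opQ] .
  qed (rule sub)
  moreover have "N - (N - W) = W" "Q - (N - W) = V" "subtopology Y N = Y"
    using sub subtopology_topspace [of Y] unfolding top by (auto simp: V_def Q_def)
  ultimately have "relative_homology_group 1 (subtopology X W) V \<cong> relative_homology_group 1 Y Q"
    by (auto simp: YW is_iso_def)
  then have 2: "cyclic_group (relative_homology_group 1 (subtopology X W) V)"
    using 1 isomorphic_group_cyclicity by (metis group_relative_homology_group)
  have "hom_boundary 1 (subtopology X W) V \<in> epi (relative_homology_group 1 (subtopology X W) V)
                    (reduced_homology_group 0 (subtopology X V))"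
  proof (rule exact_seq_trivial_imp_epi)
    show "trivial_group (reduced_homology_group 0 (subtopology X W))"
      using pcW by (simp add: path_connectedin_def trivial_reduced_homology_group_0_path_connected)
    show "exact_seq ([reduced_homology_group 0 (subtopology X W), reduced_homology_group 0 (subtopology X V),
          relative_homology_group 1 (subtopology X W) V],
          [hom_induced 0 (subtopology X V) {} (subtopology X W) {} id, hom_boundary 1 (subtopology X W) V])"
      using homology_exactness_reduced_2 [of 1 "subtopology X W" V] by (simp add: WV)
  qed
  then have "cyclic_group (reduced_homology_group 0 (subtopology X V))"
    using 2 group.cyclic_group_epimorphic_image group_reduced_homology_group group_relative_homology_group
    by blast
  then show ?thesis
    using ABC unfolding V_def by (rule cyclic_reduced_homology_group_0_imp_path_components)
qed

section \<open>\<open>H_1\<close> of complements in codimension two\<close>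

text \<open>
  The library's suspension isomorphism embeds \<open>\<real>\<^sup>m\<close> into \<open>\<real>\<^sup>m\<^sup>+\<^sup>2\<close> in the standard way, and homeomorphic closed
  sets have isomorphic complement homology, so no unknotting of \<open>S\<close> is needed.
\<close>

lemma cyclic_reduced_homology_group_1_codim_2:
  assumes S: "closedin (Euclidean_space (m + 2)) S"
    and hom: "subtopology (Euclidean_space (m + 2)) S homeomorphic_space Euclidean_space m"
  shows "cyclic_group (reduced_homology_group 1 (subtopology (Euclidean_space (m + 2)) (topspace (Euclidean_space (m + 2)) - S)))"
proof -
  let ?E = "Euclidean_space (m + 2)" and ?T = "topspace (Euclidean_space m)"
  have T: "closedin ?E ?T"
    using closedin_Euclidean_imp_closed [OF closedin_topspace [of "Euclidean_space m"]]
    by (simp add: closedin_Euclidean_space_iff)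
  have "{x::nat\<Rightarrow>real. \<forall>i\<ge>m + 2. x i = 0} \<inter> {x. \<forall>i\<ge>m. x i = 0} = {x. \<forall>i\<ge>m. x i = 0}"
    by auto
  then have ET: "subtopology ?E ?T = Euclidean_space m"
    by (simp only: topspace_Euclidean_space) (simp only: Euclidean_space_def subtopology_subtopology)
  \<comment> \<open>Invariance of dimension keeps \<open>S\<close> from filling the space. The last
    isomorphism, from relative to reduced homology, requires a nonempty complement.\<close>
  have neq: "topspace ?E - S \<noteq> {}"
  proof
    assume "topspace ?E - S = {}"
    then have "subtopology ?E S = ?E"
      by (simp add: subtopology_superset)
    then show False
      using hom invariance_of_dimension_Euclidean_space [of "m + 2" m] by simp
  qed
  have "topspace (Euclidean_space m) \<noteq> {}"
    using nontrivial_Euclidean_space by simp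
  then have "integer_group \<cong> homology_group 0 (Euclidean_space m)"
    by (metis group.iso_sym group_relative_homology_group isomorphic_integer_zeroth_homology_group path_connected_Euclidean_space)
  \<comment> \<open>The subtracted set is the whole space, so the absolute group is written as a
    relative group of a complement, ready for the step that raises degree and dimension by
    two.\<close>
  then have "integer_group \<cong> relative_homology_group 0 (Euclidean_space m) (topspace (Euclidean_space m) - ?T)"
    by simp
  also have "\<dots> \<cong> relative_homology_group (0 + int 2) ?E (topspace ?E - ?T)"
    by (rule relative_homology_group_Euclidean_complement_step) simp
  also have "\<dots> \<cong> relative_homology_group (0 + int 2) ?E (topspace ?E - S)"
    by (rule isomorphic_relative_homology_groups_Euclidean_complements [OF T S])
       (simp only: ET iffD1 [OF homeomorphic_space_sym hom])
  also have "\<dots> \<cong> reduced_homology_group ((0 + int 2) - 1) (subtopology ?E (topspace ?E - S))"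
    by (rule isomorphic_group_relative_homology_of_contractible [OF contractible_Euclidean_space]) (use neq in blast)
  finally have "integer_group \<cong> reduced_homology_group 1 (subtopology ?E (topspace ?E - S))"
    by simp
  then show ?thesis
    using isomorphic_group_cyclicity [OF _ group_integer_group group_reduced_homology_group] cyclic_integer_group by blast
qed

lemma homeomorphic_imp_homeomorphic_space:
  "S homeomorphic T \<Longrightarrow> top_of_set S homeomorphic_space top_of_set T"
  unfolding homeomorphic_def homeomorphism_def homeomorphic_space_def homeomorphic_maps_def
  by (force simp: continuous_map_in_subtopology)

text \<open>As \<open>a\<close> lies in \<open>T\<close>, puncturing the sphere at \<open>a\<close>
  first leaves the complement of \<open>T\<close> unchanged. The punctured sphere is Euclidean of
  dimension \<open>m + 2\<close>, and \<open>T - {a}\<close> is a closed copy of Euclidean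
  \<open>m\<close>-space in it.\<close>

lemma cyclic_reduced_homology_group_1_sphere_complement:
  fixes T :: "'b::euclidean_space set" and L :: "'c::euclidean_space set"
  assumes dim: "DIM('b) = m + 3" and T: "T \<subseteq> sphere 0 1" "closed T" and a: "a \<in> T"
    and L: "affine L" "aff_dim L = int m" and hom: "T - {a} homeomorphic L"
  shows "cyclic_group (reduced_homology_group 1 (top_of_set (sphere 0 1 - T)))"
proof -
  let ?E = "Euclidean_space (m + 2)" and ?X = "top_of_set (sphere (0::'b) 1 - {a})"
  obtain Z :: "'b set" where Z: "affine Z" "aff_dim Z = int (m + 2)"
    using choose_affine_subset [of "UNIV::'b set" "int (m + 2)"] dim by auto
  have "sphere (0::'b) 1 - {a} homeomorphic Z"
    by (rule homeomorphic_punctured_sphere_affine) (use a T Z dim in auto)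
  then have "?X homeomorphic_space top_of_set Z"
    by (rule homeomorphic_imp_homeomorphic_space)
  moreover have "top_of_set Z homeomorphic_space ?E"
    using Z homeomorphic_affine_Euclidean_space by blast
  ultimately have "?X homeomorphic_space ?E"
    by (rule homeomorphic_space_trans)
  then obtain f where f: "homeomorphic_map ?X ?E f"
    using homeomorphic_space by blast
  define S where "S = f ` (T - {a})"
  have sub: "T - {a} \<subseteq> topspace ?X"
    using T by auto
  have im: "f ` topspace ?X = topspace ?E"
    using f by (simp add: homeomorphic_eq_everything_map)
  have inj: "inj_on f (topspace ?X)"
    using f by (simp add: homeomorphic_eq_everything_map)
  have "closedin ?X (T - {a})"
    using T(2) sub by (auto simp: closedin_closed)
  then have S: "closedin ?E S"
    using homeomorphic_map_closedness [OF f sub] by (simp add: S_def)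
  have "homeomorphic_map (subtopology ?X (T - {a})) (subtopology ?E S) f"
    by (rule homeomorphic_map_subtopologies [OF f])
       (use sub im in \<open>auto simp: S_def\<close>)
  moreover have "subtopology ?X (T - {a}) = top_of_set (T - {a})"
    using sub by (simp add: subtopology_subtopology Int_absorb1)
  ultimately have "top_of_set (T - {a}) homeomorphic_space subtopology ?E S"
    using homeomorphic_map_imp_homeomorphic_space by metis
  moreover have "top_of_set (T - {a}) homeomorphic_space top_of_set L"
    by (rule homeomorphic_imp_homeomorphic_space [OF hom])
  moreover have "top_of_set L homeomorphic_space Euclidean_space m"
    using L homeomorphic_affine_Euclidean_space by blast
  ultimately have SE: "subtopology ?E S homeomorphic_space Euclidean_space m"
    using homeomorphic_space_sym homeomorphic_space_trans by meson
  have cyc: "cyclic_group (reduced_homology_group 1 (subtopology ?E (topspace ?E - S)))"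
    by (rule cyclic_reduced_homology_group_1_codim_2 [OF S SE])
  have "f ` (topspace ?X - (T - {a})) = topspace ?E - S"
    using inj_on_image_set_diff [OF inj _ sub, of "topspace ?X"] im by (simp only: S_def Diff_subset subset_refl)
  then have "homeomorphic_map (subtopology ?X (topspace ?X - (T - {a}))) (subtopology ?E (topspace ?E - S)) f"
    by (intro homeomorphic_map_subtopologies [OF f]) (simp only: Int_absorb1 Diff_subset)
  moreover have "subtopology ?X (topspace ?X - (T - {a})) = top_of_set (sphere 0 1 - T)"
  proof -
    have "(sphere 0 1 - {a}) \<inter> (topspace ?X - (T - {a})) = sphere 0 1 - T"
      using a by auto
    then show ?thesis by (simp only: subtopology_subtopology)
  qed
  ultimately have "top_of_set (sphere 0 1 - T) homeomorphic_space subtopology ?E (topspace ?E - S)"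
    using homeomorphic_map_imp_homeomorphic_space by metis
  then have "reduced_homology_group 1 (top_of_set (sphere 0 1 - T)) \<cong> reduced_homology_group 1 (subtopology ?E (topspace ?E - S))"
    by (rule homeomorphic_space_imp_isomorphic_reduced_homology_groups)
  then show ?thesis
    using isomorphic_group_cyclicity [OF _ group_reduced_homology_group group_reduced_homology_group] cyc by blast
qed

section \<open>Compact subsets of spheres and maps into spheres\<close>

lemma locally_path_connected_imp_path_connected_iff:
  assumes "locally path_connected S"
  shows "path_connected S \<longleftrightarrow> connected S"
  using assms
  by (simp add: path_connected_component connected_iff_connected_component path_component_eq_connected_component)

text \<open>Takes the place of stereographic projection from \<open>p\<close>.\<close>

lemma homeomorphism_punctured_sphere_UNIV:
  fixes p :: "'b::euclidean_space"
  assumes "DIM('b) = DIM('a::euclidean_space) + 1" "p \<in> sphere 0 1"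
  obtains h k where "homeomorphism (sphere 0 1 - {p}) (UNIV::'a set) h k"
proof -
  obtain Z :: "'b set" where Z: "affine Z" "aff_dim Z = int DIM('a)"
    using choose_affine_subset [of "UNIV::'b set" "int DIM('a)"] assms by auto
  have "sphere 0 1 - {p} homeomorphic Z"
    by (rule homeomorphic_punctured_sphere_affine) (use Z assms in auto)
  also have "Z homeomorphic (UNIV::'a set)"
    using Z by (intro homeomorphic_affine_sets) auto
  finally show thesis
    using that by (auto simp: homeomorphic_def)
qed

text \<open>\<open>P\<close> is contractible and the sphere is not, so some \<open>p\<close> lies
  outside \<open>P\<close>. Punctured at \<open>p\<close> the sphere is Euclidean of dimension at
  least two, where a homeomorphic copy of a compact convex set does not separate.\<close>

lemma path_connected_sphere_complement_convex_compact:
  fixes P :: "'b::euclidean_space set" and Q :: "'a::euclidean_space set"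
  assumes dim: "DIM('b) = DIM('a) + 1" "2 \<le> DIM('a)"
    and P: "P \<subseteq> sphere 0 1" and PQ: "P homeomorphic Q" and Q: "convex Q" "compact Q"
  shows "path_connected (sphere 0 1 - P)" "sphere 0 1 - P \<noteq> {}"
proof -
  have "compact P"
    using PQ Q homeomorphic_compactness by blast
  have "\<not> contractible (sphere (0::'b) 1)"
    by (simp add: contractible_sphere)
  moreover have "contractible P"
    using PQ Q homeomorphic_contractible_eq convex_imp_contractible by blast
  ultimately show ne: "sphere 0 1 - P \<noteq> {}"
    using P by (metis Diff_eq_empty_iff subset_antisym)
  then obtain p where p: "p \<in> sphere 0 1" "p \<notin> P" by blast
  obtain h :: "'b \<Rightarrow> 'a" and k where hk: "homeomorphism (sphere 0 1 - {p}) UNIV h k"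
    using homeomorphism_punctured_sphere_UNIV dim(1) p(1) by blast
  have sub: "P \<subseteq> sphere 0 1 - {p}" using P p by auto
  have "homeomorphism P (h ` P) h k"
    by (rule homeomorphism_of_subsets [OF hk sub]) auto
  then have "P homeomorphic h ` P"
    using homeomorphic_def by blast
  then have "h ` P homeomorphic Q"
    using PQ homeomorphic_sym homeomorphic_trans by metis
  then have "connected (- h ` P)"
    using connected_complement_homeomorphic_convex_compact Q dim(2) by blast
  then have "connected (k ` (- h ` P))"
    using hk by (meson connected_continuous_image continuous_on_subset homeomorphism_def subset_UNIV)
  moreover have "k ` (- h ` P) = sphere 0 1 - P - {p}"
  proof
    show "k ` (- h ` P) \<subseteq> sphere 0 1 - P - {p}"
    proof
      fix x assume "x \<in> k ` (- h ` P)"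
      then obtain y where y: "x = k y" "y \<notin> h ` P" by blast
      have "range k = sphere 0 1 - {p}" "h (k y) = y"
        using hk by (simp_all add: homeomorphism_def)
      then have "k y \<in> sphere 0 1 - {p}" "h (k y) = y"
        by blast+
      then show "x \<in> sphere 0 1 - P - {p}"
        using y by (metis DiffD1 DiffD2 DiffI imageI)
    qed
    show "sphere 0 1 - P - {p} \<subseteq> k ` (- h ` P)"
    proof
      fix x assume x: "x \<in> sphere 0 1 - P - {p}"
      then have "k (h x) = x" using hk by (simp add: homeomorphism_def)
      moreover have "h x \<notin> h ` P"
      proof
        assume "h x \<in> h ` P"
        then obtain y where "y \<in> P" "h x = h y" by auto
        then have "x = y"
          using homeomorphism_apply1 [OF hk, of y] sub \<open>k (h x) = x\<close> by (simp add: subset_iff)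
        then show False using x \<open>y \<in> P\<close> by simp
      qed
      ultimately show "x \<in> k ` (- h ` P)" by (metis ComplI imageI)
    qed
  qed
  ultimately have conn: "connected (sphere 0 1 - P - {p})" by simp
  have ope: "openin (top_of_set (sphere 0 1)) (sphere 0 1 - P)"
    using \<open>compact P\<close> unfolding Diff_eq by (intro openin_open_Int) (simp add: compact_imp_closed open_Compl)
  have "connected (sphere 0 1 - P)"
  \<comment> \<open>Putting \<open>p\<close> back preserves connectedness: the sphere is perfect and
    \<open>P\<close> is closed, so \<open>p\<close> is in the closure of the rest.\<close>
  proof (rule connected_intermediate_closure [OF conn])
    have "p islimpt sphere 0 1"
    proof (rule connected_imp_perfect)
      show "sphere 0 1 \<noteq> {x}" for x :: 'b
        using \<open>\<not> contractible (sphere (0::'b) 1)\<close> by (metis contractible_sing)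
    qed (use dim p in \<open>auto intro: connected_sphere\<close>)
    moreover have "eventually (\<lambda>y. y \<in> - P) (at p)"
      using \<open>compact P\<close> p by (intro eventually_at_in_open') (simp_all add: compact_imp_closed open_Compl)
    ultimately have "p islimpt sphere 0 1 \<inter> - P"
      by (rule islimpt_Int_eventually)
    then have "p \<in> closure (sphere 0 1 - P - {p})"
      by (simp add: islimpt_in_closure Diff_eq)
    then show "sphere 0 1 - P \<subseteq> closure (sphere 0 1 - P - {p})"
      using closure_subset [of "sphere 0 1 - P - {p}"] by blast
  qed (rule Diff_subset)
  moreover have "locally path_connected (sphere 0 1 - P)"
    using locally_open_subset [OF locally_path_connected_sphere ope] .
  ultimately show "path_connected (sphere 0 1 - P)"
    by (simp add: locally_path_connected_imp_path_connected_iff)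
qed

text \<open>Puncturing at a point \<open>p\<close> of \<open>L\<close> gives an extension problem
  for a compact set in Euclidean space, solvable off points prescribed in the bounded complementary
  components. Such a component comes from a component of the sphere minus \<open>K\<close> that
  misses \<open>p\<close>, where \<open>L\<close> supplies a point other than
  \<open>p\<close>.\<close>

lemma extend_map_sphere_to_sphere_omitting:
  fixes r :: "'b::euclidean_space \<Rightarrow> 'a::euclidean_space"
  assumes dim: "DIM('b) = DIM('a) + 1"
    and K: "compact K" "K \<subseteq> sphere 0 1"
    and r: "continuous_on K r" "r ` K \<subseteq> sphere 0 1"
    and L: "L \<subseteq> sphere 0 1 - K" "L \<noteq> {}" "\<And>C. C \<in> components (sphere 0 1 - K) \<Longrightarrow> C \<inter> L \<noteq> {}"
  obtains g where "continuous_on (sphere 0 1 - L) g" "g ` (sphere 0 1 - L) \<subseteq> sphere 0 1"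
    "\<And>x. x \<in> K \<Longrightarrow> g x = r x"
proof -
  obtain p where p: "p \<in> L" using L by auto
  then have pS: "p \<in> sphere 0 1" "p \<notin> K" using L by auto
  obtain h :: "'b \<Rightarrow> 'a" and k where hk: "homeomorphism (sphere 0 1 - {p}) UNIV h k"
    using homeomorphism_punctured_sphere_UNIV dim pS(1) by blast
  have conth: "continuous_on (sphere 0 1 - {p}) h" and contk: "continuous_on UNIV k"
    and kh: "\<And>x. x \<in> sphere 0 1 \<Longrightarrow> x \<noteq> p \<Longrightarrow> k (h x) = x" and hk': "\<And>y. h (k y) = y"
    and kran: "range k = sphere 0 1 - {p}"
    using hk by (simp_all add: homeomorphism_def)
  have kim: "k y \<in> sphere 0 1" "k y \<noteq> p" for y
    using rangeI [of k y] unfolding kran by simp_all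
  have K': "K \<subseteq> sphere 0 1 - {p}" using K pS by auto
  define S where "S = h ` K"
  have S: "compact S" unfolding S_def
    using K' K(1) conth compact_continuous_image continuous_on_subset by blast
  have kS: "k y \<in> K \<longleftrightarrow> y \<in> S" for y
  proof
    show "k y \<in> K \<Longrightarrow> y \<in> S"
      unfolding S_def using hk' [of y] by (metis imageI)
    show "k y \<in> K" if y: "y \<in> S"
    proof -
      obtain x where "x \<in> K" "y = h x" using y by (auto simp: S_def)
      moreover from this K' have "x \<in> sphere 0 1 - {p}" by blast
      ultimately show ?thesis using kh [of x] by simp
    qed
  qed
  have "continuous_on S (r \<circ> k)"
    using contk r(1) kS by (meson continuous_on_compose continuous_on_subset image_subset_iff subset_UNIV)
  moreover have "r \<circ> k \<in> S \<rightarrow> sphere 0 1"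
    using r(2) kS by auto
  moreover have meets: "B \<inter> h ` (L - {p}) \<noteq> {}" if B: "B \<in> components (- S)" "bounded B" for B
  proof -
    have Bsub: "B \<subseteq> - S" "B \<noteq> {}" "connected B"
      using B(1) by (simp_all add: in_components_nonempty in_components_subset in_components_connected)
    have "open B"
      using B(1) S by (meson compact_imp_closed open_Compl open_components)
    have clB: "closure B \<inter> - S \<subseteq> B"
      using closedin_component [OF B(1)] Bsub(1) by (metis closedin_closed closure_minimal inf.boundedI inf.cobounded2 inf_commute inf_mono order_refl)
    \<comment> \<open>\<open>B\<close> is bounded, so \<open>k ` closure B\<close> is compact and \<open>C\<close> is a whole component missing \<open>p\<close>.\<close>
    define C where "C = k ` B"
    have Csub: "C \<subseteq> sphere 0 1 - K"
      using Bsub kS kim by (auto simp: C_def)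
    have "connected C"
      unfolding C_def using contk Bsub(3) connected_continuous_image continuous_on_subset by blast
    have "C \<noteq> {}" using Bsub by (simp add: C_def)
    then obtain D where D: "D \<in> components (sphere 0 1 - K)" "C \<subseteq> D"
      using exists_component_superset [OF Csub] \<open>connected C\<close> Csub by blast
    have Dsub: "D \<subseteq> sphere 0 1 - K" "connected D"
      using D by (simp_all add: in_components_subset in_components_connected)
    have "openin (top_of_set (sphere 0 1 - {p})) C"
      unfolding C_def
      by (rule homeomorphism_imp_open_map [OF homeomorphism_symD [OF hk]]) (use \<open>open B\<close> in simp)
    then have "openin (top_of_set (sphere 0 1)) C"
      by (meson openin_delete openin_subtopology_self openin_trans)
    then have 1: "openin (top_of_set D) C"
      using D(2) Dsub(1) by (meson Diff_subset openin_subset_trans subset_trans)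
    have "compact (k ` closure B)"
      using contk B(2) by (meson compact_closure compact_continuous_image continuous_on_subset subset_UNIV)
    moreover have "C = D \<inter> k ` closure B"
    proof
      show "C \<subseteq> D \<inter> k ` closure B"
        using D(2) closure_subset by (auto simp: C_def)
      show "D \<inter> k ` closure B \<subseteq> C"
        using Dsub(1) clB kS unfolding C_def by blast
    qed
    ultimately have 2: "closedin (top_of_set D) C"
      using compact_imp_closed closedin_closed by blast
    have "C = D"
      using 1 2 \<open>C \<noteq> {}\<close> Dsub(2) by (metis connected_clopen)
    then obtain l where "l \<in> C" "l \<in> L"
      using L(3) [OF D(1)] by blast
    then obtain b where b: "b \<in> B" "l = k b" unfolding C_def by blast
    then have "h l = b" "l \<noteq> p" using hk' kim by simp_all
    then have "b \<in> h ` (L - {p})" using \<open>l \<in> L\<close> by blast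
    then show ?thesis using b by blast
  qed
  ultimately obtain K0 g where g: "K0 \<subseteq> h ` (L - {p})" "continuous_on (- K0) g"
            "g \<in> (- K0) \<rightarrow> sphere 0 1" "\<And>x. x \<in> S \<Longrightarrow> g x = (r \<circ> k) x"
    using extend_map_UNIV_to_sphere_cofinite [OF order_refl zero_le_one S, of "r \<circ> k" 0 "h ` (L - {p})"]
    by (metis (no_types, lifting) meets)
  have him: "h x \<notin> K0" if x: "x \<in> sphere 0 1 - L" for x
  proof
    assume "h x \<in> K0"
    then obtain y where y: "y \<in> L" "y \<noteq> p" "h x = h y" using g(1) by blast
    then have "k (h y) = y" using kh L(1) by blast
    moreover have "k (h x) = x" using kh x p by blast
    ultimately show False using x y by simp
  qed
  show thesis
  proof
    show "continuous_on (sphere 0 1 - L) (g \<circ> h)"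
    proof (rule continuous_on_compose)
      show "continuous_on (sphere 0 1 - L) h"
        by (rule continuous_on_subset [OF conth]) (use p in auto)
      show "continuous_on (h ` (sphere 0 1 - L)) g"
        by (rule continuous_on_subset [OF g(2)]) (use him in auto)
    qed
    show "(g \<circ> h) ` (sphere 0 1 - L) \<subseteq> sphere 0 1"
      using him g(3) by fastforce
    show "(g \<circ> h) x = r x" if "x \<in> K" for x
    proof -
      have "x \<in> sphere 0 1 - {p}" using K' that by blast
      then show ?thesis using g(4) [of "h x"] that kh [of x] by (simp add: S_def)
    qed
  qed
qed

section \<open>Spherical caps\<close>

text \<open>
  The witness moves each point along its meridian, inside the half great circle from \<open>q\<close> to \<open>- q\<close>; it
  never reaches the antipode of the point, so it is homotopic to the identity.
\<close>

lemma sphere_pinch_map: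
  fixes q :: "'a::euclidean_space"
  assumes q: "norm q = 1" and c: "-1 < c" "c < 1"
  obtains \<rho> where "continuous_on (sphere 0 1) \<rho>" "\<rho> ` sphere 0 1 \<subseteq> sphere 0 1"
    "\<And>x. x \<in> sphere 0 1 \<Longrightarrow> x \<bullet> q \<le> c \<Longrightarrow> \<rho> x = - q"
    "homotopic_with_canon (\<lambda>z. True) (sphere 0 1) (sphere 0 1) id \<rho>"
proof -
  \<comment> \<open>The part orthogonal to \<open>q\<close> is killed exactly when
    \<open>x \<bullet> q \<le> c\<close>. There the coefficient of \<open>q\<close> is at most
    \<open>c - 1 < 0\<close>, so normalising yields \<open>- q\<close>; at \<open>x = q\<close> it
    is \<open>1 - c > 0\<close>.\<close>
  define g where "g x = max 0 (x \<bullet> q - c) *\<^sub>R (x - (x \<bullet> q) *\<^sub>R q) + (2 * (x \<bullet> q) - 1 - c) *\<^sub>R q" for x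
  have qq: "q \<bullet> q = 1" using q by (simp add: norm_eq_1)
  have contg: "continuous_on (sphere 0 1) g"
    unfolding g_def by (intro continuous_intros)
  \<comment> \<open>The segment from \<open>x\<close> to \<open>g x\<close> avoids the origin, so
    the linear homotopy can be normalised; \<open>t = 1\<close> also gives
    \<open>g x \<noteq> 0\<close>. Off the poles the orthogonal part vanishes only for
    \<open>t = 1\<close> and \<open>u \<le> c\<close>, where the coefficient of \<open>q\<close> is
    negative.\<close>
  have nz: "(1 - t) *\<^sub>R x + t *\<^sub>R g x \<noteq> 0" if x: "x \<in> sphere 0 1" and t: "0 \<le> t" "t \<le> 1" for x t
  proof
    assume eq: "(1 - t) *\<^sub>R x + t *\<^sub>R g x = 0"
    define u where "u = x \<bullet> q"
    have "((1 - t) *\<^sub>R x + t *\<^sub>R g x) \<bullet> q = 0" using eq by simp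
    then have 1: "(1 - t) * u + t * (2 * u - 1 - c) = 0"
      by (simp add: g_def inner_add_left inner_diff_left qq u_def)
    have "(1 - t) *\<^sub>R x + t *\<^sub>R (a *\<^sub>R (x - u *\<^sub>R q) + b *\<^sub>R q)
        = ((1 - t) + t * a) *\<^sub>R (x - u *\<^sub>R q) + ((1 - t) * u + t * b) *\<^sub>R q" for a b
      by (simp add: algebra_simps)
    then have eq2: "(1 - t) *\<^sub>R x + t *\<^sub>R g x = ((1 - t) + t * max 0 (u - c)) *\<^sub>R (x - u *\<^sub>R q)
            + ((1 - t) * u + t * (2 * u - 1 - c)) *\<^sub>R q"
      by (simp add: g_def u_def)
    show False
    proof (cases "x = u *\<^sub>R q")
      case True
      then have "\<bar>u\<bar> = 1" using x q by (metis mem_sphere_0 mult.right_neutral norm_scaleR)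
      then consider "u = 1" | "u = -1" by linarith
      then show False
      proof cases
        case 1
        then show False using \<open>(1 - t) * u + t * (2 * u - 1 - c) = 0\<close> t c
          by (smt (verit) mult_nonneg_nonneg mult_less_cancel_left2 mult.commute mult_pos_pos)
      next
        case 2
        then have "(1 - t) + t * (3 + c) = 0" using 1 by (simp add: algebra_simps)
        then show False using t c mult_nonneg_nonneg [of t "2 + c"] by (simp add: algebra_simps)
      qed
    next
      case False
      then have "(1 - t) + t * max 0 (u - c) = 0"
        using eq eq2 1 by simp
      moreover have "0 \<le> t * max 0 (u - c)" using t by simp
      ultimately have "t = 1" "t * max 0 (u - c) = 0" using t by linarith+
      then have "t = 1" "u \<le> c" by auto
      then show False using 1 c by simp
    qed
  qed
  define \<rho> where "\<rho> x = g x /\<^sub>R norm (g x)" for x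
  have gnz: "g x \<noteq> 0" if "x \<in> sphere 0 1" for x
    using nz [OF that, of 1] by simp
  have n: "continuous_map (top_of_set (- {0})) (top_of_set (sphere 0 1)) (\<lambda>x::'a. x /\<^sub>R norm x)"
    by (auto simp: intro!: continuous_intros)
  have "homotopic_with_canon (\<lambda>z. True) (sphere 0 1) (- {0}) id g"
  proof (rule homotopic_with_linear [OF continuous_on_id' contg])
    fix x :: 'a assume x: "x \<in> sphere 0 1"
    show "closed_segment (id x) (g x) \<subseteq> - {0}"
      using nz [OF x] by (auto simp: closed_segment_def)
  qed
  then have "homotopic_with_canon (\<lambda>z. True) (sphere 0 1) (sphere 0 1) ((\<lambda>x::'a. x /\<^sub>R norm x) \<circ> id) ((\<lambda>x::'a. x /\<^sub>R norm x) \<circ> g)"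
    by (rule homotopic_with_compose_continuous_map_left [OF _ n]) auto
  then have hom: "homotopic_with_canon (\<lambda>z. True) (sphere 0 1) (sphere 0 1) id \<rho>"
    by (rule homotopic_with_eq) (auto simp: \<rho>_def)
  show thesis
  proof (rule that [OF _ _ _ hom])
    show "continuous_on (sphere 0 1) \<rho>"
      unfolding \<rho>_def by (intro continuous_intros contg) (use gnz in auto)
    show "\<rho> ` sphere 0 1 \<subseteq> sphere 0 1"
      using gnz by (auto simp: \<rho>_def)
    show "\<rho> x = - q" if "x \<in> sphere 0 1" "x \<bullet> q \<le> c" for x
    proof -
      have "g x = - ((1 + c - 2 * (x \<bullet> q)) *\<^sub>R q)"
        using that by (simp add: g_def max_def algebra_simps)
      moreover have "1 + c - 2 * (x \<bullet> q) > 0" using that c by simp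
      ultimately show ?thesis by (simp add: \<rho>_def q)
    qed
  qed
qed

text \<open>Orthogonal projection along \<open>q\<close> maps the cap onto a disc in a hyperplane.
  Since \<open>0 \<le> c\<close>, the height over the disc is the nonnegative square root, which
  gives the inverse.\<close>

lemma homeomorphic_spherical_cap:
  fixes q :: "'a::euclidean_space"
  assumes q: "norm q = 1" and c: "0 \<le> c" "c < 1"
  obtains Q :: "'a set" where "convex Q" "compact Q" "{x \<in> sphere 0 1. c \<le> x \<bullet> q} homeomorphic Q"
proof
  have qq: "q \<bullet> q = 1" using q by (simp add: norm_eq_1)
  let ?Q = "cball 0 (sqrt (1 - c\<^sup>2)) \<inter> {y. q \<bullet> y = 0}"
  have c2: "c\<^sup>2 \<le> 1" using c by (simp add: power_le_one)
  show "convex ?Q" by (intro convex_Int convex_cball convex_hyperplane)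
  show "compact ?Q" by (intro compact_Int_closed compact_cball closed_hyperplane)
  have pyth: "(norm (x - (x \<bullet> q) *\<^sub>R q))\<^sup>2 = 1 - (x \<bullet> q)\<^sup>2" if "norm x = 1" for x
  proof -
    have "x \<bullet> x = 1" using that by (simp add: norm_eq_1)
    then show ?thesis unfolding power2_norm_eq_inner
      by (simp add: inner_diff_left inner_diff_right qq inner_commute power2_eq_square algebra_simps)
  qed
  have pyth2: "(norm (y + s *\<^sub>R q))\<^sup>2 = (norm y)\<^sup>2 + s\<^sup>2" if "q \<bullet> y = 0" for y s
    using that unfolding power2_norm_eq_inner
    by (simp add: inner_add_left inner_add_right qq inner_commute power2_eq_square algebra_simps)
  have ny: "(norm y)\<^sup>2 \<le> 1 - c\<^sup>2" if "norm y \<le> sqrt (1 - c\<^sup>2)" for y :: 'a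
    using that by (metis c2 diff_ge_0_iff_ge norm_ge_zero power_mono real_sqrt_pow2)
  show "{x \<in> sphere 0 1. c \<le> x \<bullet> q} homeomorphic ?Q"
  proof -
    let ?f = "\<lambda>x. x - (x \<bullet> q) *\<^sub>R q" and ?g = "\<lambda>y. y + sqrt (1 - (norm y)\<^sup>2) *\<^sub>R q"
    have gf: "?g (?f x) = x" if "x \<in> {x \<in> sphere 0 1. c \<le> x \<bullet> q}" for x
      using that pyth c by simp
    have fg: "?f (?g y) = y" if "y \<in> ?Q" for y
      using that by (simp add: inner_add_left inner_add_right qq inner_commute)
    have fim: "?f x \<in> ?Q" if "x \<in> {x \<in> sphere 0 1. c \<le> x \<bullet> q}" for x
    proof -
      have "(norm (?f x))\<^sup>2 \<le> 1 - c\<^sup>2"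
        using pyth that c by (simp add: power_mono)
      then have "norm (?f x) \<le> sqrt (1 - c\<^sup>2)"
        by (simp add: real_le_rsqrt)
      then show ?thesis by (simp add: inner_diff_right qq inner_commute)
    qed
    have gim: "?g y \<in> {x \<in> sphere 0 1. c \<le> x \<bullet> q}" if "y \<in> ?Q" for y
    proof -
      have le: "(norm y)\<^sup>2 \<le> 1 - c\<^sup>2" using ny that by simp
      then have "(norm y)\<^sup>2 \<le> 1" using zero_le_power2 [of c] by linarith
      then have "(norm (?g y))\<^sup>2 = 1"
        using that by (subst pyth2) auto
      then have "norm (?g y) = 1"
        by (metis abs_norm_cancel power2_eq_1_iff abs_one abs_minus)
      moreover have "c \<le> sqrt (1 - (norm y)\<^sup>2)"
        using le by (intro real_le_rsqrt) simp
      ultimately show ?thesis using that by (simp add: inner_add_left inner_add_right qq inner_commute)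
    qed
    have "?f ` {x \<in> sphere 0 1. c \<le> x \<bullet> q} = ?Q"
    proof
      show "?Q \<subseteq> ?f ` {x \<in> sphere 0 1. c \<le> x \<bullet> q}"
        using gim by (metis (no_types, lifting) fg image_eqI subsetI)
    qed (use fim in blast)
    moreover have "?g ` ?Q = {x \<in> sphere 0 1. c \<le> x \<bullet> q}"
    proof
      show "{x \<in> sphere 0 1. c \<le> x \<bullet> q} \<subseteq> ?g ` ?Q"
        using fim by (metis (no_types, lifting) gf image_eqI subsetI)
    qed (use gim in blast)
    ultimately show ?thesis
      by (rule homeomorphicI [OF _ _ _ _ gf fg]) (intro continuous_intros)+
  qed
qed

text \<open>The hyperplane at height \<open>c\<close> cuts out a round \<open>m\<close>-sphere with
  centre \<open>c *\<^sub>R q\<close> and radius \<open>sqrt (1 - c\<^sup>2)\<close>. For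
  \<open>m = 0\<close> this is a pair of points and \<open>L\<close> is a single point.\<close>

lemma homeomorphic_punctured_spherical_cap_boundary:
  fixes q :: "'a::euclidean_space"
  assumes q: "norm q = 1" and c: "0 \<le> c" "c < 1" and dim: "DIM('a) = m + 2"
  obtains a and L :: "'a set" where "a \<in> {x \<in> sphere 0 1. x \<bullet> q = c}" "affine L" "aff_dim L = int m"
    "{x \<in> sphere 0 1. x \<bullet> q = c} - {a} homeomorphic L"
proof -
  have qq: "q \<bullet> q = 1" using q by (simp add: norm_eq_1)
  have "q \<noteq> 0" using q by auto
  have c2: "c\<^sup>2 < 1" using c by (simp add: power_less_one_iff)
  define s where "s = sqrt (1 - c\<^sup>2)"
  have s: "s > 0" "s\<^sup>2 = 1 - c\<^sup>2" using c2 by (auto simp: s_def)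
  have pyth: "(dist (c *\<^sub>R q) x)\<^sup>2 = (norm x)\<^sup>2 - c\<^sup>2" if "q \<bullet> x = c" for x
    using that unfolding dist_norm power2_norm_eq_inner
    by (simp add: inner_diff_left inner_diff_right qq inner_commute power2_eq_square algebra_simps)
  have iff: "norm x = 1 \<longleftrightarrow> dist (c *\<^sub>R q) x = s" if "q \<bullet> x = c" for x
  proof -
    have "dist (c *\<^sub>R q) x = s \<longleftrightarrow> (dist (c *\<^sub>R q) x)\<^sup>2 = s\<^sup>2"
      using s(1) by (simp add: power2_eq_iff_nonneg)
    also have "\<dots> \<longleftrightarrow> (norm x)\<^sup>2 = 1\<^sup>2"
      using pyth [OF that] s by auto
    also have "\<dots> \<longleftrightarrow> norm x = 1" by (subst power2_eq_iff_nonneg) auto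
    finally show ?thesis by simp
  qed
  have eq: "{x \<in> sphere 0 1. x \<bullet> q = c} = sphere (c *\<^sub>R q) s \<inter> {x. q \<bullet> x = c}"
    using iff by (auto simp: inner_commute)
  obtain e where e: "e \<noteq> 0" "orthogonal q e"
    using orthogonal_to_vector_exists [of q] dim by auto
  define a where "a = c *\<^sub>R q + s *\<^sub>R (e /\<^sub>R norm e)"
  have a: "a \<in> sphere (c *\<^sub>R q) s" "q \<bullet> a = c"
    using e s by (auto simp: a_def dist_norm inner_add_right qq orthogonal_def)
  obtain L :: "'a set" where L: "affine L" "aff_dim L = int m"
    using choose_affine_subset [of "UNIV::'a set" "int m"] dim by auto
  have "sphere (c *\<^sub>R q) s \<inter> {x. q \<bullet> x = c} - {a} homeomorphic L"
    by (rule homeomorphic_punctured_affine_sphere_affine)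
       (use s a L qq dim \<open>q \<noteq> 0\<close> in \<open>simp_all add: affine_hyperplane aff_dim_hyperplane\<close>)
  with that [of a L] a L show thesis
    unfolding eq by simp
qed

section \<open>Maps that are injective on a cap\<close>

lemma path_components_of_top_of_set:
  assumes "locally path_connected S"
  shows "path_components_of (top_of_set S) = components S"
proof -
  have "path_component_of_set (top_of_set S) x = connected_component_set S x" for x
    by (auto simp: path_component_eq_connected_component [OF assms])
  then show ?thesis
    by (simp add: path_components_of_def components_def)
qed

text \<open>On the sphere \<open>g \<circ> f\<close> is \<open>\<rho>\<close>, which is homotopic to
  the identity. Composing a nullhomotopy of \<open>f\<close> with \<open>g\<close> would therefore
  contract the sphere.\<close>

lemma not_nullhomotopic_if_factors_identity:
  fixes \<rho> :: "'a::euclidean_space \<Rightarrow> 'a"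
  assumes \<rho>: "homotopic_with_canon (\<lambda>z. True) (sphere 0 1) (sphere 0 1) id \<rho>"
    and g: "continuous_on Z g" "g ` Z \<subseteq> sphere 0 1" "\<And>x. x \<in> sphere 0 1 \<Longrightarrow> g (f x) = \<rho> x"
  shows "\<not> homotopic_with_canon (\<lambda>z. True) (sphere 0 1) Z f (\<lambda>x. a)"
proof
  assume "homotopic_with_canon (\<lambda>z. True) (sphere 0 1) Z f (\<lambda>x. a)"
  then have "homotopic_with_canon (\<lambda>z. True) (sphere 0 1) (sphere 0 1) (g \<circ> f) (g \<circ> (\<lambda>x. a))"
    by (rule homotopic_with_compose_continuous_map_left) (use g in auto)
  then have "homotopic_with_canon (\<lambda>z. True) (sphere 0 1) (sphere 0 1) \<rho> (\<lambda>x. g a)"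
    by (rule homotopic_with_eq) (use g in auto)
  then have "homotopic_with_canon (\<lambda>z. True) (sphere 0 1) (sphere 0 1) id (\<lambda>x. g a)"
    by (rule homotopic_with_trans [OF \<rho>])
  then have "contractible (sphere (0::'a) 1)"
    unfolding contractible_def by blast
  then show False
    by (simp add: contractible_sphere)
qed

text \<open>The two spheres have dimensions \<open>m + 1\<close> and \<open>m + 2\<close>; thus
  \<open>m\<close> is \<open>n - 1\<close>, the dimension of the rim. The bound
  \<open>0 \<le> c\<close> keeps the cap in a hemisphere, where it projects onto a disc.\<close>

locale sphere_map_injective_cap =
  fixes f :: "'a::euclidean_space \<Rightarrow> 'b::euclidean_space" and q :: 'a and c :: real and m :: nat
  assumes dim_dom: "DIM('a) = m + 2" and dim_cod: "DIM('b) = m + 3"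
    and contf: "continuous_on (sphere 0 1) f" and fim: "f ` sphere 0 1 \<subseteq> sphere 0 1"
    and q: "norm q = 1" and c: "0 \<le> c" "c < 1"
    and cap: "\<And>x. x \<in> sphere 0 1 \<Longrightarrow> c \<le> x \<bullet> q \<Longrightarrow> x \<in> injective_points (sphere 0 1) f"
begin

text \<open>In the notation of the opening remarks \<open>Cap\<close> is D and the image of
  \<open>Rest\<close> is A. \<open>Cap\<close> and \<open>Rest\<close> are both closed and overlap
  in \<open>Rim\<close>, so that all three images are compact.\<close>

definition "Cap = {x \<in> sphere 0 1. c \<le> x \<bullet> q}"
definition "Rim = {x \<in> sphere 0 1. x \<bullet> q = c}"
definition "Rest = {x \<in> sphere 0 1. x \<bullet> q \<le> c}"
definition "W = connected_component_set (sphere 0 1 - f ` Rest) (f q)"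
definition "V = W - f ` sphere 0 1"

lemma f_eqD: "x = y" if "f x = f y" "x \<in> Cap" "y \<in> sphere 0 1"
  using cap [of x] that by (auto simp: injective_points_def Cap_def)

lemma Cap_subset: "Cap \<subseteq> sphere 0 1" and Rim_subset_Cap: "Rim \<subseteq> Cap" and Rim_subset_Rest: "Rim \<subseteq> Rest"
  and Rest_subset: "Rest \<subseteq> sphere 0 1" and Cap_Un_Rest: "Cap \<union> Rest = sphere 0 1"
  by (auto simp: Cap_def Rim_def Rest_def)

lemma compact_caps: "compact Cap" "compact Rim" "compact Rest"
proof -
  have *: "Cap = sphere 0 1 \<inter> {x. q \<bullet> x \<ge> c}" "Rim = sphere 0 1 \<inter> {x. q \<bullet> x = c}"
    "Rest = sphere 0 1 \<inter> {x. q \<bullet> x \<le> c}"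
    by (auto simp: Cap_def Rim_def Rest_def inner_commute)
  show "compact Cap" "compact Rim" "compact Rest"
    unfolding * by (intro compact_Int_closed compact_sphere closed_halfspace_ge closed_hyperplane closed_halfspace_le)+
qed

lemma compact_images: "compact (f ` sphere 0 1)" "compact (f ` Cap)" "compact (f ` Rim)" "compact (f ` Rest)"
  using compact_caps contf Cap_subset Rim_subset_Cap Rest_subset compact_sphere
  by (meson compact_continuous_image continuous_on_subset order_trans)+

lemma q_mem: "q \<in> sphere 0 1" "q \<in> Cap" "q \<notin> Rest"
  using q c by (auto simp: Cap_def Rest_def norm_eq_1)

lemma image_Rest_iff: "f x \<in> f ` Rest \<longleftrightarrow> x \<in> Rest" if "x \<in> sphere 0 1"
proof
  assume "f x \<in> f ` Rest"
  then obtain y where y: "f x = f y" "y \<in> Rest" by auto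
  show "x \<in> Rest"
  proof (rule ccontr)
    assume "x \<notin> Rest"
    then have "x \<in> Cap" using that Cap_Un_Rest by blast
    then have "x = y" using f_eqD y Rest_subset by blast
    then show False using y \<open>x \<notin> Rest\<close> by simp
  qed
qed auto

lemma openin_W: "openin (top_of_set (sphere 0 1)) W"
proof -
  have "openin (top_of_set (sphere 0 1)) (sphere 0 1 - f ` Rest)"
    using compact_images unfolding Diff_eq by (intro openin_open_Int) (simp add: compact_imp_closed open_Compl)
  then show ?thesis
    unfolding W_def using locally_connected_sphere locally_connected_open_connected_component
    by (metis locally_open_subset openin_connected_component_locally_connected openin_trans)
qed

lemma W_subset: "W \<subseteq> sphere 0 1 - f ` Rest"
  unfolding W_def by (rule connected_component_subset)

lemma connected_W: "connected W"
  unfolding W_def by simp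

text \<open>Each point \<open>x\<close> other than \<open>q\<close> lies with \<open>q\<close> in
  the closed cap whose rim passes through \<open>x\<close>, and that cap is homeomorphic to a convex
  set.\<close>

lemma connected_open_cap: "connected (Cap - Rest)"
proof -
  have "connected_component (Cap - Rest) q x" if x: "x \<in> Cap - Rest" for x
  proof (cases "x = q")
    case True
    then show ?thesis using x by simp
  next
    case False
    have nx: "norm x = 1" "c < x \<bullet> q" using x by (auto simp: Cap_def Rest_def)
    have "x \<bullet> q \<noteq> 1"
      using False nx q by (metis inner_commute norm_cauchy_schwarz_eq mult_1 scaleR_one)
    then have lt: "x \<bullet> q < 1"
      using norm_cauchy_schwarz [of x q] nx q by simp
    obtain Q :: "'a set" where Q: "convex Q" "{y \<in> sphere 0 1. x \<bullet> q \<le> y \<bullet> q} homeomorphic Q"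
      using homeomorphic_spherical_cap [OF q _ lt] nx c by auto
    then have "connected {y \<in> sphere 0 1. x \<bullet> q \<le> y \<bullet> q}"
      using convex_connected homeomorphic_connectedness by blast
    moreover have "{y \<in> sphere 0 1. x \<bullet> q \<le> y \<bullet> q} \<subseteq> Cap - Rest"
      using nx by (auto simp: Cap_def Rest_def)
    moreover have "q \<in> {y \<in> sphere 0 1. x \<bullet> q \<le> y \<bullet> q}" "x \<in> {y \<in> sphere 0 1. x \<bullet> q \<le> y \<bullet> q}"
      using lt q nx by (auto simp: norm_eq_1)
    ultimately show ?thesis
      unfolding connected_component_def by blast
  qed
  then show ?thesis
    unfolding connected_iff_connected_component
    by (meson connected_component_sym connected_component_trans)
qed

lemma image_open_cap_subset_W: "f ` (Cap - Rest) \<subseteq> W"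
  unfolding W_def
proof (rule connected_component_maximal)
  show "f q \<in> f ` (Cap - Rest)" using q_mem by blast
  show "connected (f ` (Cap - Rest))"
    using contf Cap_subset by (intro connected_continuous_image connected_open_cap) (meson Diff_subset continuous_on_subset order_trans)
  show "f ` (Cap - Rest) \<subseteq> sphere 0 1 - f ` Rest"
    using fim Cap_subset image_Rest_iff by fastforce
qed

text \<open>The form in which \<open>W\<close> enters the excision argument. Off the rim the cap is
  the open cap, whose image lies in \<open>W\<close>, while the rim belongs to
  \<open>Rest\<close>.\<close>

lemma W_Int_image_Cap: "W \<inter> f ` Cap = f ` Cap - f ` Rim"
proof
  have "f ` Rim \<subseteq> f ` Rest" using Rim_subset_Rest by (rule image_mono)
  then show "W \<inter> f ` Cap \<subseteq> f ` Cap - f ` Rim" using W_subset by blast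
  have "Cap - Rim \<subseteq> Cap - Rest" by (auto simp: Cap_def Rim_def Rest_def)
  then show "f ` Cap - f ` Rim \<subseteq> W \<inter> f ` Cap" using image_open_cap_subset_W by blast
qed

lemma V_eq: "V = W - f ` Cap"
proof -
  have "f ` sphere 0 1 = f ` Cap \<union> f ` Rest"
    using Cap_Un_Rest by (metis image_Un)
  then show ?thesis using W_subset unfolding V_def by blast
qed

lemma W_decomp: "W = V \<union> f ` (Cap - Rest)"
proof -
  have "W \<inter> f ` Cap \<subseteq> f ` (Cap - Rest)"
    using W_subset by blast
  then show ?thesis using image_open_cap_subset_W unfolding V_eq by blast
qed

lemma openin_V: "openin (top_of_set (sphere 0 1)) V"
  unfolding V_eq Diff_eq
  by (intro openin_Int_open openin_W) (simp add: compact_images compact_imp_closed open_Compl)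

lemma V_subset: "V \<subseteq> sphere 0 1"
  using openin_V openin_imp_subset by blast

lemma homeomorphism_Cap: obtains g where "homeomorphism Cap (f ` Cap) f g"
proof -
  have "inj_on f Cap" using f_eqD Cap_subset by (auto simp: inj_on_def)
  moreover have "continuous_on Cap f" using contf Cap_subset continuous_on_subset by blast
  ultimately show ?thesis using homeomorphism_compact [OF compact_caps(1)] that by blast
qed

section \<open>At most two components\<close>

lemma components_V_le_2:
  assumes "X \<in> components V" "Y \<in> components V" "Z \<in> components V"
  shows "X = Y \<or> Y = Z \<or> X = Z"
proof -
  obtain g where g: "homeomorphism Cap (f ` Cap) f g" by (rule homeomorphism_Cap)
  obtain Q :: "'a set" where Q: "convex Q" "compact Q" "Cap homeomorphic Q"
    using homeomorphic_spherical_cap [OF q c] unfolding Cap_def by blast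
  have "f ` Cap homeomorphic Cap"
    using g homeomorphic_def homeomorphic_sym by blast
  then have capQ: "f ` Cap homeomorphic Q"
    using Q(3) by (rule homeomorphic_trans)
  have capS: "f ` Cap \<subseteq> sphere 0 1"
    using fim Cap_subset by blast
  have pc: "path_connected (sphere 0 1 - f ` Cap)" "sphere 0 1 - f ` Cap \<noteq> {}"
    using path_connected_sphere_complement_convex_compact [OF _ _ capS capQ Q(1,2)] dim_dom dim_cod by auto
  obtain a and L :: "'a set" where a: "a \<in> Rim" and L: "affine L" "aff_dim L = int m" "Rim - {a} homeomorphic L"
    using homeomorphic_punctured_spherical_cap_boundary [OF q c dim_dom] unfolding Rim_def by blast
  have "f ` (Rim - {a}) = f ` Rim - {f a}"
    using a f_eqD Rim_subset_Cap Cap_subset by blast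
  then have "homeomorphism (Rim - {a}) (f ` Rim - {f a}) f g"
    using homeomorphism_of_subsets [OF g] Rim_subset_Cap by (metis Diff_subset order_trans subset_refl)
  then have "f ` Rim - {f a} homeomorphic Rim - {a}"
    using homeomorphic_def homeomorphic_sym by blast
  then have "f ` Rim - {f a} homeomorphic L"
    using L(3) by (rule homeomorphic_trans)
  then have cyc: "cyclic_group (reduced_homology_group 1 (top_of_set (sphere 0 1 - f ` Rim)))"
    using a L(1,2) capS Rim_subset_Cap
    by (intro cyclic_reduced_homology_group_1_sphere_complement [OF dim_cod]) (auto simp: compact_images compact_imp_closed)
  let ?X = "top_of_set (sphere (0::'b) 1)"
  have sub: "subtopology ?X (sphere 0 1 - M) = top_of_set (sphere 0 1 - M)" for M
    by (simp add: subtopology_subtopology Int_absorb1)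
  have subV: "subtopology ?X V = top_of_set V"
    using V_subset by (simp add: subtopology_subtopology Int_absorb1)
  have lpc: "locally path_connected V" "locally path_connected W"
    using locally_open_subset locally_path_connected_sphere openin_V openin_W by blast+
  \<comment> \<open>\<open>V\<close> is open in the sphere and hence locally path connected, so its
    components are the path components counted by \<open>H_0\<close>.\<close>
  have *: "path_components_of (subtopology ?X (W - f ` Cap)) = components V"
    using path_components_of_top_of_set [OF lpc(1)] subV by (simp add: V_eq)
  show ?thesis
  proof (rule path_components_of_open_minus_closed [of ?X "f ` Cap" "f ` Rim" W])
    show "closedin ?X (f ` Cap)" "closedin ?X (f ` Rim)"
      using capS Rim_subset_Cap compact_images by (auto intro!: closed_subset simp: compact_imp_closed)
    show "f ` Rim \<subseteq> f ` Cap" using Rim_subset_Cap by (rule image_mono)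
    show "cyclic_group (reduced_homology_group 1 (subtopology ?X (topspace ?X - f ` Rim)))"
      using cyc by (simp add: sub)
    show "path_connectedin ?X (topspace ?X - f ` Cap)"
      using pc by (simp add: path_connectedin_subtopology)
    show "path_connectedin ?X W"
      using connected_W lpc(2) W_subset
      by (auto simp: path_connectedin_subtopology locally_path_connected_imp_path_connected_iff)
  qed (use pc openin_W W_Int_image_Cap assms * in auto)
qed

section \<open>At least two components, and extensions to the ball\<close>

lemma collapse_map:
  obtains \<rho> r where "homotopic_with_canon (\<lambda>z. True) (sphere (0::'a) 1) (sphere 0 1) id \<rho>"
    "continuous_on (sphere 0 1 - V) r" "r ` (sphere 0 1 - V) \<subseteq> sphere (0::'a) 1"
    "\<And>x. x \<in> sphere 0 1 \<Longrightarrow> r (f x) = \<rho> x"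
proof -
  obtain \<rho> where \<rho>: "continuous_on (sphere 0 1) \<rho>" "\<rho> ` sphere 0 1 \<subseteq> sphere 0 1"
    "\<And>x. x \<in> sphere 0 1 \<Longrightarrow> x \<bullet> q \<le> c \<Longrightarrow> \<rho> x = - q"
    "homotopic_with_canon (\<lambda>z. True) (sphere (0::'a) 1) (sphere 0 1) id \<rho>"
    using sphere_pinch_map [OF q, of c] c by auto
  have \<rho>Rest: "\<rho> x = - q" if "x \<in> Rest" for x
    using \<rho>(3) that by (auto simp: Rest_def)
  obtain g where g: "homeomorphism Cap (f ` Cap) f g" by (rule homeomorphism_Cap)
  have gf: "g (f x) = x" if "x \<in> Cap" for x using g that by (simp add: homeomorphism_def)
  \<comment> \<open>The cap is unrolled by the inverse \<open>g\<close> and pinched by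
    \<open>\<rho>\<close>; everything else goes to \<open>- q\<close>, the value of
    \<open>\<rho>\<close> on \<open>Rest\<close>.\<close>
  define r where "r y = (if y \<in> f ` Cap then \<rho> (g y) else - q)" for y
  have rf: "r (f x) = \<rho> x" if x: "x \<in> sphere 0 1" for x
  proof (cases "x \<in> Cap")
    case True
    then show ?thesis by (simp add: r_def gf)
  next
    case False
    then have "x \<in> Rest" using x Cap_Un_Rest by blast
    moreover have "f x \<notin> f ` Cap"
    proof
      assume "f x \<in> f ` Cap"
      then obtain y where "f y = f x" "y \<in> Cap" by force
      then show False using f_eqD [of y x] x False by simp
    qed
    ultimately show ?thesis by (simp add: r_def \<rho>Rest)
  qed
  have eq: "sphere 0 1 - V = f ` Cap \<union> (sphere 0 1 - W)"
    using V_eq fim Cap_subset by blast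
  \<comment> \<open>The two closed pieces of the domain overlap in the image of the rim, which
    \<open>r\<close> also sends to \<open>- q\<close>. So \<open>r\<close> is continuous on their
    union.\<close>
  have rW: "r y = - q" if "y \<in> sphere 0 1 - W" for y
  proof (cases "y \<in> f ` Cap")
    case True
    then have "y \<in> f ` Rim" using that W_Int_image_Cap by blast
    then obtain x where x: "x \<in> Rim" "y = f x" by blast
    then have "x \<in> Rest" "x \<in> sphere 0 1" using Rim_subset_Rest Rest_subset by blast+
    then show ?thesis
      using rf [of x] \<rho>Rest [of x] x by simp
  qed (simp add: r_def)
  have "continuous_on (f ` Cap) (\<rho> \<circ> g)"
  proof (rule continuous_on_compose)
    show "continuous_on (f ` Cap) g" using g by (simp add: homeomorphism_def)
    have "g ` f ` Cap = Cap" using g by (simp add: homeomorphism_def)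
    then show "continuous_on (g ` f ` Cap) \<rho>"
      using \<rho>(1) Cap_subset continuous_on_subset by metis
  qed
  then have 1: "continuous_on (f ` Cap) r"
    by (rule continuous_on_eq) (simp add: r_def)
  have 2: "continuous_on (sphere 0 1 - W) r"
    by (rule continuous_on_eq [OF continuous_on_const [of _ "- q"]]) (simp add: rW)
  have "closed (sphere 0 1 - W)"
    using openin_W by (metis closedin_closed_trans closed_sphere closedin_diff closedin_topspace topspace_euclidean_subtopology)
  then have cont: "continuous_on (sphere 0 1 - V) r"
    unfolding eq using 1 2 by (intro continuous_on_closed_Un) (simp_all add: compact_images compact_imp_closed)
  have "r ` f ` Cap \<subseteq> sphere 0 1"
    using rf \<rho>(2) Cap_subset by fastforce
  moreover have "r ` (sphere 0 1 - W) \<subseteq> sphere 0 1"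
    using rW q by auto
  ultimately have rim: "r ` (sphere 0 1 - V) \<subseteq> sphere 0 1"
    unfolding eq image_Un by simp
  show thesis
    by (rule that [OF \<rho>(4) cont rim rf])
qed

text \<open>The collapse map lives on the complement of \<open>V\<close>, which contains the image
  of \<open>f\<close>. It extends to the complement of \<open>L\<close> because \<open>L\<close>
  meets every component of \<open>V\<close>, and the extension composed with \<open>f\<close> is
  still \<open>\<rho>\<close>.\<close>

lemma not_nullhomotopic_avoiding:
  assumes L: "L \<subseteq> V" "L \<noteq> {}" "\<And>X. X \<in> components V \<Longrightarrow> X \<inter> L \<noteq> {}"
  shows "\<not> homotopic_with_canon (\<lambda>z. True) (sphere 0 1) (sphere 0 1 - L) f (\<lambda>x. a)"
proof -
  obtain \<rho> r where \<rho>: "homotopic_with_canon (\<lambda>z. True) (sphere (0::'a) 1) (sphere 0 1) id \<rho>"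
    and r: "continuous_on (sphere 0 1 - V) r" "r ` (sphere 0 1 - V) \<subseteq> sphere (0::'a) 1"
    "\<And>x. x \<in> sphere 0 1 \<Longrightarrow> r (f x) = \<rho> x"
    using collapse_map by blast
  have VV: "sphere 0 1 - (sphere 0 1 - V) = V" using V_subset by blast
  have "compact (sphere 0 1 - V)"
    using openin_V by (metis closedin_compact compact_sphere closedin_diff closedin_topspace topspace_euclidean_subtopology)
  then obtain g where g: "continuous_on (sphere 0 1 - L) g" "g ` (sphere 0 1 - L) \<subseteq> sphere 0 1"
    "\<And>y. y \<in> sphere 0 1 - V \<Longrightarrow> g y = r y"
    using extend_map_sphere_to_sphere_omitting [of "sphere 0 1 - V" r L] r(1,2) L dim_dom dim_cod
    unfolding VV by auto
  have "g (f x) = \<rho> x" if "x \<in> sphere 0 1" for x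
  proof -
    have "f x \<in> sphere 0 1 - V" using that fim unfolding V_def by blast
    then show ?thesis using g(3) r(3) that by simp
  qed
  then show ?thesis
    by (rule not_nullhomotopic_if_factors_identity [OF \<rho> g(1,2)])
qed

text \<open>If \<open>V\<close> were empty, the collapse map would be defined on the whole target
  sphere and make \<open>f\<close> essential, but maps into a sphere of higher dimension are
  nullhomotopic.\<close>

lemma V_nonempty: "V \<noteq> {}"
proof
  assume V: "V = {}"
  obtain \<rho> r where \<rho>: "homotopic_with_canon (\<lambda>z. True) (sphere (0::'a) 1) (sphere 0 1) id \<rho>"
    and r: "continuous_on (sphere 0 1 - V) r" "r ` (sphere 0 1 - V) \<subseteq> sphere (0::'a) 1"
    "\<And>x. x \<in> sphere 0 1 \<Longrightarrow> r (f x) = \<rho> x"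
    using collapse_map by blast
  obtain a where "homotopic_with_canon (\<lambda>z. True) (sphere 0 1) (sphere 0 1) f (\<lambda>x. a)"
    using inessential_spheremap_lowdim [of 0 1 f 0 1] contf fim dim_dom dim_cod by auto
  then show False
    using not_nullhomotopic_if_factors_identity [OF \<rho> r] V by simp
qed

text \<open>If \<open>V\<close> were connected, one point \<open>p\<close> would serve as
  \<open>L\<close>. The sphere without \<open>p\<close> is contractible, so \<open>f\<close> would
  be nullhomotopic there.\<close>

lemma not_connected_V: "\<not> connected V"
proof
  assume conn: "connected V"
  obtain p where p: "p \<in> V" using V_nonempty by blast
  have "components V = {V}" using conn V_nonempty by (simp add: components_eq_sing_iff)
  then have ess: "\<not> homotopic_with_canon (\<lambda>z. True) (sphere 0 1) (sphere 0 1 - {p}) f (\<lambda>x. a)" for a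
    using p by (intro not_nullhomotopic_avoiding) auto
  obtain h :: "'b \<Rightarrow> 'a" and k where "homeomorphism (sphere 0 1 - {p}) UNIV h k"
    by (rule homeomorphism_punctured_sphere_UNIV [of p]) (use V_subset p dim_dom dim_cod in auto)
  then have "contractible (sphere 0 1 - {p})"
    using homeomorphic_contractible_eq contractible_UNIV homeomorphic_def by blast
  moreover have "f \<in> sphere 0 1 \<rightarrow> sphere 0 1 - {p}"
    using p fim unfolding V_def by blast
  ultimately show False
    using ess nullhomotopic_into_contractible [OF contf] by blast
qed

lemma two_components:
  obtains U1 U2 where "U1 \<noteq> U2" "components V = {U1, U2}"
    "\<And>F. continuous_on (cball 0 1) F \<Longrightarrow> F ` cball 0 1 \<subseteq> sphere 0 1 \<Longrightarrow>
       (\<And>x. x \<in> sphere 0 1 \<Longrightarrow> F x = f x) \<Longrightarrow> U1 \<subseteq> F ` cball 0 1 \<or> U2 \<subseteq> F ` cball 0 1"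
proof -
  obtain U1 where U1: "U1 \<in> components V"
    using V_nonempty components_eq_empty by blast
  have "components V \<noteq> {U1}"
    using not_connected_V by (metis Union_components ccpo_Sup_singleton in_components_connected U1)
  then obtain U2 where U2: "U2 \<in> components V" "U1 \<noteq> U2"
    using U1 by blast
  have eq: "components V = {U1, U2}"
    using components_V_le_2 [OF U1 U2(1)] U1 U2 by blast
  show thesis
  proof (rule that [OF U2(2) eq])
    fix F :: "'a \<Rightarrow> 'b"
    assume F: "continuous_on (cball 0 1) F" "F ` cball 0 1 \<subseteq> sphere 0 1"
       "\<And>x. x \<in> sphere 0 1 \<Longrightarrow> F x = f x"
    show "U1 \<subseteq> F ` cball 0 1 \<or> U2 \<subseteq> F ` cball 0 1"
    proof (rule ccontr)
      assume "\<not> ?thesis"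
      then obtain u1 u2 where u: "u1 \<in> U1" "u1 \<notin> F ` cball 0 1" "u2 \<in> U2" "u2 \<notin> F ` cball 0 1"
        by blast
      have "U1 \<subseteq> V" "U2 \<subseteq> V" using U1 U2 in_components_subset by blast+
      \<comment> \<open>One missed point in each component suffices for \<open>L\<close>, while an
        extension to the ball that avoids both points is the same as a nullhomotopy of
        \<open>f\<close> avoiding them.\<close>
      then have ess: "\<not> homotopic_with_canon (\<lambda>z. True) (sphere 0 1) (sphere 0 1 - {u1, u2}) f (\<lambda>x. a)" for a
        using u by (intro not_nullhomotopic_avoiding) (auto simp: eq)
      have "F ` cball 0 1 \<subseteq> sphere 0 1 - {u1, u2}" using F(2) u by blast
      then have "\<exists>a. homotopic_with_canon (\<lambda>z. True) (sphere 0 1) (sphere 0 1 - {u1, u2}) f (\<lambda>x. a)"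
        unfolding nullhomotopic_from_sphere_extension using F(1,3) by blast
      then show False using ess by blast
    qed
  qed
qed

section \<open>Dependence on the cap\<close>

lemma components_V_eq:
  "components V = {X \<in> components (sphere 0 1 - f ` sphere 0 1). X \<inter> W \<noteq> {}}"
proof -
  have V_sub: "V \<subseteq> sphere 0 1 - f ` sphere 0 1"
    using V_subset unfolding V_def by blast
  \<comment> \<open>A connected set off the image of \<open>f\<close> is also off the image of
    \<open>Rest\<close>. If it meets the component \<open>W\<close> of that larger complement, it
    lies inside \<open>W\<close>.\<close>
  have sub_V: "X \<subseteq> V" if X: "X \<subseteq> sphere 0 1 - f ` sphere 0 1" "connected X" "X \<inter> W \<noteq> {}" for X
  proof -
    obtain y where y: "y \<in> X" "y \<in> W" using X by blast
    have "W = connected_component_set (sphere 0 1 - f ` Rest) y"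
      using y(2) unfolding W_def by (rule connected_component_eq [symmetric])
    moreover have "X \<subseteq> sphere 0 1 - f ` Rest" using X(1) Rest_subset by blast
    ultimately have "X \<subseteq> W" using connected_component_maximal [OF y(1) X(2)] by blast
    then show ?thesis using X(1) unfolding V_def by blast
  qed
  show ?thesis
  proof (intro subset_antisym subsetI)
    fix X assume X: "X \<in> components V"
    have Xp: "X \<noteq> {}" "X \<subseteq> V" "connected X"
      using X by (simp_all add: in_components_nonempty in_components_subset in_components_connected)
    then have XW: "X \<inter> W \<noteq> {}" unfolding V_def by blast
    have "X \<in> components (sphere 0 1 - f ` sphere 0 1)"
      unfolding in_components_maximal
    proof (intro conjI allI impI)
      show "X \<subseteq> sphere 0 1 - f ` sphere 0 1" using Xp(2) V_sub by (rule order_trans)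
      fix D assume D: "D \<noteq> {} \<and> X \<subseteq> D \<and> D \<subseteq> sphere 0 1 - f ` sphere 0 1 \<and> connected D"
      then have "D \<subseteq> V" using XW by (intro sub_V) auto
      then show "D = X" using X D unfolding in_components_maximal by blast
    qed (use Xp in auto)
    then show "X \<in> {X \<in> components (sphere 0 1 - f ` sphere 0 1). X \<inter> W \<noteq> {}}"
      using XW by simp
  next
    fix X assume "X \<in> {X \<in> components (sphere 0 1 - f ` sphere 0 1). X \<inter> W \<noteq> {}}"
    then have X: "X \<in> components (sphere 0 1 - f ` sphere 0 1)" "X \<inter> W \<noteq> {}" by auto
    then have "X \<subseteq> V"
      by (intro sub_V) (auto simp: in_components_connected dest: in_components_subset)
    then show "X \<in> components V"
      using X(1) V_sub unfolding in_components_maximal by (meson order_trans)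
  qed
qed

text \<open>Otherwise \<open>X\<close> would be open and closed in the connected set
  \<open>W\<close>: open as a component of the open set \<open>V\<close>, closed because its closure
  misses the image of the open cap, which is all that \<open>W\<close> adds to \<open>V\<close>. But
  \<open>W\<close> contains \<open>f q\<close>, which lies in \<open>B\<close>.\<close>

lemma component_V_meets:
  assumes X: "X \<in> components V" and B: "open B" "f ` (Cap - Rest) \<subseteq> B"
  shows "X \<inter> B \<noteq> {}"
proof
  assume XB: "X \<inter> B = {}"
  have Xp: "X \<noteq> {}" "X \<subseteq> V"
    using X by (simp_all add: in_components_nonempty in_components_subset)
  have XW: "X \<subseteq> W" using Xp(2) unfolding V_def by blast
  have "locally connected V"
    using locally_open_subset [OF locally_connected_sphere openin_V] .
  then have "openin (top_of_set (sphere 0 1)) X"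
    using X openin_V openin_components_locally_connected openin_trans by blast
  then have 1: "openin (top_of_set W) X"
    using XW W_subset by (meson Diff_subset openin_subset_trans order_trans)
  have "closure X \<inter> B = {}"
    using XB B(1) by (simp add: open_Int_closure_eq_empty Int_commute)
  moreover have "closure X \<inter> V = X"
  proof -
    obtain T where T: "closed T" "X = V \<inter> T"
      using closedin_component [OF X] unfolding closedin_closed by blast
    then have "closure X \<subseteq> T" by (intro closure_minimal) auto
    then show ?thesis using T(2) closure_subset [of X] by blast
  qed
  ultimately have "X = W \<inter> closure X"
    using W_decomp B(2) XW by blast
  then have 2: "closedin (top_of_set W) X"
    by (metis closed_closure closedin_closed_Int)
  have "X = W"
    using 1 2 Xp(1) connected_W by (metis connected_clopen)
  moreover have "f q \<in> W" "f q \<in> B"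
    using q_mem B(2) image_open_cap_subset_W by blast+
  ultimately show False using XB by blast
qed

end

section \<open>Small caps and the final theorem\<close>

lemma spherical_cap_subset_ball:
  fixes q :: "'a::euclidean_space"
  assumes "norm q = 1" "e > 0"
  obtains c where "0 \<le> c" "c < 1" "\<And>x. x \<in> sphere 0 1 \<Longrightarrow> c \<le> x \<bullet> q \<Longrightarrow> dist x q < e"
proof
  \<comment> \<open>The squared distance from \<open>x\<close> to \<open>q\<close> is
    \<open>2 - 2 * (x \<bullet> q)\<close>, so this height bounds it by half of
    \<open>e\<^sup>2\<close>. The maximum with \<open>0\<close> keeps the cap in a
    hemisphere.\<close>
  let ?c = "max 0 (1 - e\<^sup>2 / 4)"
  show "0 \<le> ?c" "?c < 1" using assms by auto
  show "dist x q < e" if "x \<in> sphere 0 1" "?c \<le> x \<bullet> q" for x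
  proof -
    have "x \<bullet> x = 1" "q \<bullet> q = 1" using that assms by (simp_all add: norm_eq_1)
    then have "(dist x q)\<^sup>2 = 2 - 2 * (x \<bullet> q)"
      unfolding dist_norm power2_norm_eq_inner by (simp add: inner_diff_left inner_diff_right inner_commute)
    also have "\<dots> \<le> e\<^sup>2 / 2" using that(2) by simp
    also have "\<dots> < e\<^sup>2" using assms by simp
    finally show ?thesis using assms by (meson less_imp_le power_less_imp_less_base)
  qed
qed

theorem theorem1p3:
  fixes n :: nat
    and f :: "'a::euclidean_space \<Rightarrow> 'b::euclidean_space"
    and U :: "'a set" and q :: 'a
  assumes "n \<ge> 1"
    and "DIM('a) = n + 1" and "DIM('b) = n + 2"
    and "continuous_on (sphere 0 1) f"
    and "f ` sphere 0 1 \<subseteq> sphere 0 1"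
    and "openin (top_of_set (sphere 0 1)) U"
    and "U \<subseteq> injective_points (sphere 0 1) f"
    and "q \<in> U"
  shows "\<not> connected (sphere 0 1 - f ` sphere 0 1)
    \<and> \<Union> (components (sphere 0 1 - f ` sphere 0 1)) = sphere 0 1 - f ` sphere 0 1
    \<and> disjoint (components (sphere 0 1 - f ` sphere 0 1))
    \<and> (\<forall>C \<in> components (sphere 0 1 - f ` sphere 0 1). openin (top_of_set (sphere 0 1)) C)
    \<and> (\<exists>U\<^sub>1 U\<^sub>2. U\<^sub>1 \<noteq> U\<^sub>2
          \<and> {C \<in> components (sphere 0 1 - f ` sphere 0 1). f q \<in> closure C} = {U\<^sub>1, U\<^sub>2}
          \<and> (\<forall>F :: 'a \<Rightarrow> 'b.
                continuous_on (cball 0 1) F \<and> F ` cball 0 1 \<subseteq> sphere 0 1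
                \<and> (\<forall>x \<in> sphere 0 1. F x = f x)
                \<longrightarrow> U\<^sub>1 \<subseteq> F ` cball 0 1 \<or> U\<^sub>2 \<subseteq> F ` cball 0 1))"
proof -
  let ?K = "sphere 0 1 - f ` sphere 0 1"
  have qS: "norm q = 1"
    using assms(6,8) openin_imp_subset by force
  obtain e where e: "e > 0" "\<And>x. x \<in> sphere 0 1 \<Longrightarrow> dist x q < e \<Longrightarrow> x \<in> U"
    using assms(6,8) unfolding openin_euclidean_subtopology_iff by blast
  have dims: "DIM('a) = (n - 1) + 2" "DIM('b) = (n - 1) + 3"
    using assms(1-3) by auto
  have cap: "sphere_map_injective_cap f q c (n - 1)"
    if "0 \<le> c" "c < 1" "\<And>x. x \<in> sphere 0 1 \<Longrightarrow> c \<le> x \<bullet> q \<Longrightarrow> dist x q < e" for c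
    using that e(2) assms(4,5,7) qS dims by unfold_locales blast+
  obtain c where c: "0 \<le> c" "c < 1" "\<And>x. x \<in> sphere 0 1 \<Longrightarrow> c \<le> x \<bullet> q \<Longrightarrow> dist x q < e"
    using spherical_cap_subset_ball [OF qS e(1)] by blast
  interpret c: sphere_map_injective_cap f q c "n - 1"
    using c by (rule cap)
  obtain U1 U2 where U12: "U1 \<noteq> U2" "components c.V = {U1, U2}"
    and F: "\<And>F. continuous_on (cball 0 1) F \<Longrightarrow> F ` cball 0 1 \<subseteq> sphere 0 1 \<Longrightarrow>
       (\<And>x. x \<in> sphere 0 1 \<Longrightarrow> F x = f x) \<Longrightarrow> U1 \<subseteq> F ` cball 0 1 \<or> U2 \<subseteq> F ` cball 0 1"
    using c.two_components by blast
  have fqW: "f q \<in> c.W"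
    using c.q_mem c.image_open_cap_subset_W by blast
  \<comment> \<open>A smaller cap whose image lies in \<open>B\<close> has the same two components,
    and for that cap \<open>component_V_meets\<close> applies to \<open>B\<close>.\<close>
  have near: "X \<inter> B \<noteq> {}" if X: "X \<in> components c.V" and B: "open B" "f q \<in> B" for X B
  proof -
    have "\<exists>d>0. \<forall>x\<in>sphere 0 1. dist x q < d \<longrightarrow> f x \<in> B"
    proof -
      obtain r where r: "r > 0" "ball (f q) r \<subseteq> B" using B open_contains_ball by blast
      obtain d where "d > 0" "\<And>x. x \<in> sphere 0 1 \<Longrightarrow> dist x q < d \<Longrightarrow> dist (f x) (f q) < r"
        using assms(4) c.q_mem(1) r(1) unfolding continuous_on_iff by metis
      then show ?thesis using r(2) by (metis dist_commute mem_ball subsetD)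
    qed
    then obtain d where d: "d > 0" "\<And>x. x \<in> sphere 0 1 \<Longrightarrow> dist x q < d \<Longrightarrow> f x \<in> B" by blast
    obtain c1 where c1: "0 \<le> c1" "c1 < 1" "\<And>x. x \<in> sphere 0 1 \<Longrightarrow> c1 \<le> x \<bullet> q \<Longrightarrow> dist x q < d"
      using spherical_cap_subset_ball [OF qS d(1)] by blast
    \<comment> \<open>At least \<open>c\<close>, so that the new cap lies in the old one, and at
      least \<open>c1\<close>, so that its image lies in \<open>B\<close>.\<close>
    define c' where "c' = max c c1"
    interpret c': sphere_map_injective_cap f q c' "n - 1"
      using c c1 by (intro cap) (auto simp: c'_def)
    have cc': "c \<le> c'" "c1 \<le> c'" by (simp_all add: c'_def)
    have "c.Rest \<subseteq> c'.Rest"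
      using cc' by (auto simp: c.Rest_def c'.Rest_def)
    then have "c'.W \<subseteq> c.W"
      unfolding c.W_def c'.W_def by (intro connected_component_mono) blast
    \<comment> \<open>Both families consist of components of the same complement, selected by
      meeting \<open>W\<close>, so a smaller \<open>W\<close> selects fewer. As each family has
      exactly two members, they coincide.\<close>
    then have sub: "components c'.V \<subseteq> {U1, U2}"
      unfolding U12(2) [symmetric] c.components_V_eq c'.components_V_eq by blast
    obtain Y Z where YZ: "Y \<noteq> Z" "components c'.V = {Y, Z}"
      by (rule c'.two_components) (rule that)
    have "Y \<in> {U1, U2}" "Z \<in> {U1, U2}" using sub YZ(2) by simp_all
    then have "{Y, Z} = {U1, U2}" using YZ(1) by auto
    then have "components c'.V = components c.V"
      using YZ(2) U12(2) by simp
    moreover have "f ` (c'.Cap - c'.Rest) \<subseteq> B"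
      using d(2) c1(3) cc' by (auto simp: c'.Cap_def)
    ultimately show ?thesis
      using c'.component_V_meets X B(1) by blast
  qed
  have eq: "{C \<in> components ?K. f q \<in> closure C} = components c.V"
  proof (intro subset_antisym subsetI)
    fix C assume "C \<in> {C \<in> components ?K. f q \<in> closure C}"
    then have C: "C \<in> components ?K" "f q \<in> closure C" by auto
    obtain T where T: "open T" "c.W = sphere 0 1 \<inter> T"
      using c.openin_W unfolding openin_open by blast
    \<comment> \<open>\<open>W\<close> is a relative neighbourhood of \<open>f q\<close>, so a
      component with \<open>f q\<close> in its closure must enter \<open>W\<close>.\<close>
    have "T \<inter> C \<noteq> {}"
      using C(2) T fqW open_Int_closure_eq_empty [of T C] by blast
    moreover have "C \<subseteq> sphere 0 1" using C(1) in_components_subset by blast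
    ultimately have "C \<inter> c.W \<noteq> {}" unfolding T(2) by blast
    then show "C \<in> components c.V" unfolding c.components_V_eq using C(1) by blast
  next
    fix C assume C: "C \<in> components c.V"
    then have "f q \<in> closure C"
      using near by (auto simp: closure_iff_nhds_not_empty)
    then show "C \<in> {C \<in> components ?K. f q \<in> closure C}"
      using C unfolding c.components_V_eq by blast
  qed
  have "{U1, U2} \<subseteq> components ?K" using eq U12(2) by blast
  then have nc: "\<not> connected ?K"
    using U12(1) by (metis connected_eq_connected_components_eq insert_subset)
  have "openin (top_of_set (sphere 0 1)) ?K"
    using c.compact_images(1) unfolding Diff_eq by (intro openin_open_Int) (simp add: compact_imp_closed open_Compl)
  then have "\<forall>C \<in> components ?K. openin (top_of_set (sphere 0 1)) C"
    using locally_open_subset [OF locally_connected_sphere] openin_components_locally_connected openin_trans by blast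
  moreover have "disjoint (components ?K)"
    using pairwise_disjoint_components [of ?K] by (simp add: pairwise_def disjnt_def)
  ultimately show ?thesis
    using nc U12 eq F by (intro conjI exI [of _ U1] exI [of _ U2] Union_components allI impI) auto
qed

end
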